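(* There exists an absolute constant $c>0$ such that the following holds. Let $N \geq 1+\exp(e^e)$ be an integer and let $A,B,C$ be nonempty subsets of $\mathbb{Z}/N\mathbb{Z}$ of respective densities $\alpha=|A|/N$, $\beta=|B|/N$, $\gamma=|C|/N$. If $$\alpha\,\Big(\log \tfrac{2}{\alpha\beta\gamma}\Big)^{-7} \geq (c\log N)^{-1},$$ then $A+B+C$ contains an arithmetic progression of length at least $$N^{\,c\,\alpha/\log^5(2/\alpha\beta\gamma)}$$ such that each element of the progression has at least $\exp\big(-(c\alpha)^{-1}\log^7(2/\alpha\beta\gamma)\big)\,N^2$ representations as a sum $x+y+z$ with $(x,y,z)\in A\times B\times C$.
   Context: All logarithms are natural logarithms. *)

theory Defs
  imports Complex_Main
begin

text \<open>Z/NZ is modelled by the residues {0..<N} with addition mod N.\<close>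

definition sumset3 :: "nat \<Rightarrow> nat set \<Rightarrow> nat set \<Rightarrow> nat set \<Rightarrow> nat set" where
  "sumset3 N A B C = {(x + y + z) mod N | x y z. x \<in> A \<and> y \<in> B \<and> z \<in> C}"

definition reps3 :: "nat \<Rightarrow> nat set \<Rightarrow> nat set \<Rightarrow> nat set \<Rightarrow> nat \<Rightarrow> nat" where
  "reps3 N A B C t = card {(x, y, z). x \<in> A \<and> y \<in> B \<and> z \<in> C \<and> (x + y + z) mod N = t mod N}"

definition ap_mod :: "nat \<Rightarrow> nat \<Rightarrow> nat \<Rightarrow> nat \<Rightarrow> nat set" where
  "ap_mod N a d L = (\<lambda>i. (a + i * d) mod N) ` {..<L}"

definition proper_ap_mod :: "nat \<Rightarrow> nat \<Rightarrow> nat \<Rightarrow> nat \<Rightarrow> bool" where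
  "proper_ap_mod N a d L \<longleftrightarrow> inj_on (\<lambda>i. (a + i * d) mod N) {..<L}"

end

(* Write f = 1_A * mu_B, where mu_X is the uniform probability measure on X, and h = log(1 + 4 f / alpha).
   Approximating f by an average of translates of 1_A at k = O(Lambda^3 / alpha) random points of B, with
   Chernoff errors measured relative to f + alpha / 4, and then pigeonholing, gives a set S of density at
   least beta^k / 2 such that the translates of h by S nearly agree; the relative error is what makes k
   linear in 1 / alpha, and taking logarithms turns it into a translation-invariant additive error. Hence
   h is close to its smoothing by l = O(Lambda) copies of S - S, which by Parseval is nearly invariant
   under the Bohr set of the large spectrum of S. By Chang's theorem this Bohr set has rank
   O(log(N / |S|)) = O(Lambda^4 / alpha), so Dirichlet's theorem finds a long progression in it. All
   closeness is measured against probability densities of height at most 1 / (alpha gamma); applied to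
   the one proportional to f on x - C, where (f * mu_C)(x) >= alpha, it gives f * mu_C >= alpha / 2 on the
   translate of the progression by x. No density increment is needed. *)

theory Submission
  imports Defs "HOL-Analysis.Analysis"
begin

section \<open>Fourier analysis on the residues modulo \<open>N\<close>\<close>

text \<open>The powers of \<Lambda> come from one chain of costs. Both sqrt M, the price of passing
  from an L2 bound to densities of height M/N, and the height of h are bounded by multiples of exp
  \<Lambda>, so the smoothed function has to be invariant up to \<eta> of order exp(-2 \<Lambda>). A
  frequency outside the large spectrum shrinks by a factor 1/4 or better in each smoothing, which
  puts l at order \<Lambda>. Every smoothing costs one sampling error, so this error must be of
  order 1/\<Lambda>. Chernoff at that accuracy, with exceptional sets small against fixed powers of
  exp \<Lambda>, asks for k of order \<Lambda>^3/\<alpha>. Pigeonholing costs a factor \<beta>^k in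
  the density of S, and its logarithm adds the fourth power of \<Lambda> in the rank. The floor
  \<alpha>/4 inside the logarithm keeps h bounded where f vanishes. When the logarithm is undone, it
  costs \<alpha>/4 out of the average \<alpha>; the total loss in h costs another quarter, and
  \<alpha>/2 is left.\<close>

locale cyclic =
  fixes N :: nat
  assumes N_pos: "N > 0"
begin

definition res :: "int set" where
  "res = {0..<int N}"

text \<open>Functions on Z/NZ are kept as periodic functions on all integers, so that translates and
  reflections need no reduction; sums run over the fundamental domain \<open>res\<close>.\<close>

definition periodic :: "(int \<Rightarrow> 'a) \<Rightarrow> bool" where
  "periodic f \<longleftrightarrow> (\<forall>x. f (x mod int N) = f x)"

text \<open>The additive character of frequency \<open>r\<close>. It is symmetric in
  \<open>r\<close> and \<open>x\<close>, so orthogonality and subadditivity are available in either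
  variable.\<close>

definition ee :: "int \<Rightarrow> int \<Rightarrow> complex" where
  "ee r x = cis (2 * pi * (of_int r * of_int x) / real N)"

lemma finite_res [simp]: "finite res" and card_res [simp]: "card res = N"
  by (simp_all add: res_def)

lemma mod_in_res [simp]: "x mod int N \<in> res"
  using N_pos by (simp add: res_def)

lemma mod_res_id: "x \<in> res \<Longrightarrow> x mod int N = x"
  by (simp add: res_def)

lemma periodicD: "periodic f \<Longrightarrow> x mod int N = y mod int N \<Longrightarrow> f x = f y"
  by (metis periodic_def)

lemma periodicI: "(\<And>x k. f (x + k * int N) = f x) \<Longrightarrow> periodic f"
  unfolding periodic_def by (metis mod_div_decomp add.commute add.right_neutral mult.commute mod_mult_div_eq)

lemma periodic_add_mult: "periodic f \<Longrightarrow> f (x + k * int N) = f x"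
  by (rule periodicD) auto

lemma periodic_shift: "periodic f \<Longrightarrow> periodic (\<lambda>x. f (x + t))"
  by (rule periodicI) (simp add: algebra_simps, metis periodic_add_mult add.assoc mult.commute)

lemma bij_betw_shift: "bij_betw (\<lambda>x. (x + t) mod int N) res res"
  by (rule bij_betw_byWitness[where f' = "\<lambda>x. (x - t) mod int N"])
    (auto simp: mod_simps mod_res_id)

lemma sum_periodic_shift:
  assumes "periodic f"
  shows "(\<Sum>x\<in>res. f (x + t)) = (\<Sum>x\<in>res. f x)"
proof -
  have "(\<Sum>x\<in>res. f x) = (\<Sum>x\<in>res. f ((x + t) mod int N))"
    by (rule sum.reindex_bij_betw[OF bij_betw_shift, symmetric])
  then show ?thesis using assms by (simp add: periodic_def)
qed

lemma sum_periodic_reflect: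
  assumes "periodic f"
  shows "(\<Sum>x\<in>res. f (t - x)) = (\<Sum>x\<in>res. f x)"
proof -
  have "bij_betw (\<lambda>x. (t - x) mod int N) res res"
    by (rule bij_betw_byWitness[where f' = "\<lambda>x. (t - x) mod int N"])
      (auto simp: mod_simps mod_res_id)
  then have "(\<Sum>x\<in>res. f x) = (\<Sum>x\<in>res. f ((t - x) mod int N))"
    by (rule sum.reindex_bij_betw[symmetric])
  then show ?thesis using assms by (simp add: periodic_def)
qed

lemma ee_add: "ee r (x + y) = ee r x * ee r y"
  by (simp add: ee_def cis_mult ring_distribs add_divide_distrib)

lemma ee_add_left: "ee (r + s) x = ee r x * ee s x"
  by (simp add: ee_def cis_mult ring_distribs add_divide_distrib)

lemma ee_commute: "ee r x = ee x r"
  by (simp add: ee_def mult.commute)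

lemma ee_zero [simp]: "ee 0 x = 1" "ee r 0 = 1"
  by (simp_all add: ee_def)

lemma norm_ee [simp]: "norm (ee r x) = 1"
  by (simp add: ee_def)

lemma ee_minus: "ee r (- x) = cnj (ee r x)" "ee (- r) x = cnj (ee r x)"
  by (simp_all add: ee_def cis_cnj)

lemma ee_diff: "ee r (x - y) = ee r x * cnj (ee r y)"
  using ee_add[of r x "-y"] by (simp add: ee_minus)

lemma ee_sum: "ee (\<Sum>d\<in>D. a d) x = (\<Prod>d\<in>D. ee (a d) x)"
  by (induction D rule: infinite_finite_induct) (simp_all add: ee_add_left)

lemma ee_mult_N [simp]: "ee r (k * int N) = 1"
  using N_pos cis_multiple_2pi[of "of_int (r * k)"] by (simp add: ee_def field_simps)

lemma periodic_ee: "periodic (ee r)"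
  by (rule periodicI) (simp add: ee_add)

lemma ee_eq_1_iff: "ee r 1 = 1 \<longleftrightarrow> int N dvd r"
proof
  assume "ee r 1 = 1"
  then obtain k :: int where k: "2 * pi * of_int r / real N = of_int (2 * k) * pi"
    unfolding ee_def cis_conv_exp exp_eq_1 by auto
  then have "real_of_int r = of_int (k * int N)"
    using N_pos by (simp add: field_simps)
  then show "int N dvd r" by (metis of_int_eq_iff dvd_triv_right)
next
  assume "int N dvd r"
  then obtain k where "r = k * int N" by (metis dvd_def mult.commute)
  then show "ee r 1 = 1" by (subst ee_commute) simp
qed

text \<open>Orthogonality of characters: translation by 1 preserves the sum but multiplies it by
  \<open>ee r 1\<close>, which differs from 1 unless \<open>N\<close> divides
  \<open>r\<close>.\<close>

lemma sum_ee: "(\<Sum>x\<in>res. ee r x) = (if int N dvd r then of_nat N else 0)"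
proof (cases "int N dvd r")
  case True
  then obtain k where "r = k * int N" by (metis dvd_def mult.commute)
  then have "ee r x = 1" for x by (simp add: ee_commute[of "k * int N"])
  then show ?thesis using True by simp
next
  case False
  have "(\<Sum>x\<in>res. ee r x) = ee r 1 * (\<Sum>x\<in>res. ee r x)"
    using sum_periodic_shift[OF periodic_ee, of r 1] by (simp add: ee_add sum_distrib_left mult.commute)
  with False show ?thesis by (simp add: ee_eq_1_iff)
qed

text \<open>Multiplication by a unimodular number is an isometry, so the distance from 1 is
  subadditive in the frequency. All Bohr set estimates rest on this.\<close>

lemma norm_ee_minus_1_add: "norm (ee (r + s) x - 1) \<le> norm (ee r x - 1) + norm (ee s x - 1)"
proof -
  have "ee (r + s) x - 1 = ee r x * (ee s x - 1) + (ee r x - 1)"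
    by (simp add: ee_add_left algebra_simps)
  then have "norm (ee (r + s) x - 1) \<le> norm (ee r x * (ee s x - 1)) + norm (ee r x - 1)"
    by (metis norm_triangle_ineq)
  then show ?thesis by (simp add: norm_mult)
qed

lemma norm_ee_minus: "norm (ee (- r) x - 1) = norm (ee r x - 1)"
  by (metis complex_cnj_diff complex_cnj_one complex_mod_cnj ee_minus(2))

text \<open>Control at the few frequencies in \<open>D\<close> thus passes to all their signed sums,
  which will include the whole large spectrum.\<close>

lemma norm_ee_minus_1_sum:
  assumes "\<And>d. d \<in> D \<Longrightarrow> \<epsilon> d \<in> {-1, 0, 1 :: int}"
  shows "norm (ee (\<Sum>d\<in>D. \<epsilon> d * d) x - 1) \<le> (\<Sum>d\<in>D. norm (ee d x - 1))"
  using assms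
proof (induction D rule: infinite_finite_induct)
  case (insert d D)
  have "norm (ee (\<epsilon> d * d) x - 1) \<le> norm (ee d x - 1)"
    using insert.prems[of d] by (auto simp: norm_ee_minus)
  moreover have "norm (ee (\<Sum>d\<in>D. \<epsilon> d * d) x - 1) \<le> (\<Sum>d\<in>D. norm (ee d x - 1))"
    using insert by auto
  ultimately show ?case
    using insert.hyps norm_ee_minus_1_add[of "\<epsilon> d * d" "\<Sum>d\<in>D. \<epsilon> d * d" x] by simp
qed auto

lemma norm_ee_minus_1_mult: "norm (ee r (int i * x) - 1) \<le> real i * norm (ee r x - 1)"
proof (induction i)
  case (Suc i)
  have "norm (ee x (r + int i * r) - 1) \<le> norm (ee r x - 1) + norm (ee r (int i * x) - 1)"
    using norm_ee_minus_1_add[of r "int i * r" x] by (simp add: ee_def mult_ac)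
  with Suc show ?case by (simp add: ee_def algebra_simps)
qed simp

text \<open>With \<theta> the offset from the integer \<open>p\<close>, the chord from 1 has length
  2 |sin(pi \<theta>)|, which is at most the arc 2 pi |\<theta>|.\<close>

lemma norm_ee_minus_1_le:
  assumes "\<bar>of_int r * of_int x / real N - of_int p\<bar> \<le> \<delta>"
  shows "norm (ee r x - 1) \<le> 2 * pi * \<delta>"
proof -
  define \<theta> where "\<theta> = of_int r * of_int x / real N - of_int p"
  have "ee r x = cis (2 * pi * \<theta> + 2 * pi * of_int p)"
    by (simp add: ee_def \<theta>_def algebra_simps)
  also have "\<dots> = cis (2 * pi * \<theta>)"
    by (simp only: cis_mult[symmetric]) (simp add: cis_multiple_2pi)
  finally have "norm (ee r x - 1) = norm (exp (\<i> * of_real (2 * pi * \<theta>)) - 1)"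
    by (simp add: cis_conv_exp)
  also have "\<dots> = 2 * \<bar>sin (pi * \<theta>)\<bar>"
    by (subst dist_exp_i_1) simp
  also have "\<dots> \<le> 2 * \<bar>pi * \<theta>\<bar>"
    using abs_sin_x_le_abs_x[of "pi * \<theta>"] by simp
  also have "\<dots> \<le> 2 * pi * \<delta>"
    using assms by (simp add: \<theta>_def abs_mult)
  finally show ?thesis .
qed

text \<open>Unnormalised, hence the factor \<open>N\<close> in \<open>parseval\<close>.\<close>

definition fourier :: "(int \<Rightarrow> complex) \<Rightarrow> int \<Rightarrow> complex" where
  "fourier f r = (\<Sum>x\<in>res. f x * ee (- r) x)"

lemma parseval: "(\<Sum>r\<in>res. (norm (fourier f r))\<^sup>2) = real N * (\<Sum>x\<in>res. (norm (f x))\<^sup>2)"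
proof -
  have "(norm (fourier f r))\<^sup>2 = (\<Sum>x\<in>res. \<Sum>y\<in>res. f x * cnj (f y) * ee (y - x) r)" for r
  proof -
    have "complex_of_real ((norm (fourier f r))\<^sup>2) = fourier f r * cnj (fourier f r)"
      by (rule complex_norm_square)
    also have "\<dots> = (\<Sum>x\<in>res. \<Sum>y\<in>res. f x * ee (-r) x * (cnj (f y) * cnj (ee (-r) y)))"
      by (simp add: fourier_def cnj_sum sum_product)
    also have "\<dots> = (\<Sum>x\<in>res. \<Sum>y\<in>res. f x * cnj (f y) * ee (y - x) r)"
      by (intro sum.cong refl) (simp add: ee_minus ee_diff[of r] ee_commute[of _ r])
    finally show ?thesis .
  qed
  then have "complex_of_real (\<Sum>r\<in>res. (norm (fourier f r))\<^sup>2)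
      = (\<Sum>r\<in>res. \<Sum>x\<in>res. \<Sum>y\<in>res. f x * cnj (f y) * ee (y - x) r)"
    by simp
  also have "\<dots> = (\<Sum>x\<in>res. \<Sum>r\<in>res. \<Sum>y\<in>res. f x * cnj (f y) * ee (y - x) r)"
    by (rule sum.swap)
  also have "\<dots> = (\<Sum>x\<in>res. \<Sum>y\<in>res. \<Sum>r\<in>res. f x * cnj (f y) * ee (y - x) r)"
    by (rule sum.cong[OF refl], rule sum.swap)
  \<comment> \<open>Summing over the frequency leaves only the diagonal, since distinct members of
    \<open>res\<close> are incongruent.\<close>
  also have "\<dots> = (\<Sum>x\<in>res. \<Sum>y\<in>res. f x * cnj (f y) * (if y = x then of_nat N else 0))"
  proof (intro sum.cong refl)
    fix x y assume "x \<in> res" "y \<in> res"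
    then have "int N dvd (y - x) \<longleftrightarrow> y = x"
      by (metis diff_self dvd_0_right mod_eq_dvd_iff mod_res_id)
    then show "(\<Sum>r\<in>res. f x * cnj (f y) * ee (y - x) r) = f x * cnj (f y) * (if y = x then of_nat N else 0)"
      by (simp add: sum_distrib_left[symmetric] sum_ee)
  qed
  also have "\<dots> = (\<Sum>x\<in>res. f x * cnj (f x) * of_nat N)"
    by (intro sum.cong refl) (simp add: if_distrib[where f = "\<lambda>u. _ * u"] sum.delta cong: if_cong)
  also have "\<dots> = complex_of_real (real N * (\<Sum>x\<in>res. (norm (f x))\<^sup>2))"
    by (simp add: sum_distrib_left complex_norm_square mult.commute del: of_real_power)
  finally show ?thesis using of_real_eq_iff by blast
qed

lemma fourier_shift:
  assumes "periodic f"
  shows "fourier (\<lambda>x. f (x + t)) r = ee r t * fourier f r"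
proof -
  have "periodic (\<lambda>x. f x * ee (- r) (x - t))"
    using assms periodic_shift[OF periodic_ee, of "-r" "-t"] by (auto simp: periodic_def)
  from sum_periodic_shift[OF this, of t]
  have "fourier (\<lambda>x. f (x + t)) r = (\<Sum>x\<in>res. f x * ee (- r) (x - t))"
    by (simp add: fourier_def)
  also have "\<dots> = ee r t * fourier f r"
    unfolding fourier_def sum_distrib_left
    by (intro sum.cong refl) (simp add: ee_diff ee_minus)
  finally show ?thesis .
qed

lemma fourier_sum: "fourier (\<lambda>x. \<Sum>i\<in>I. g i x) r = (\<Sum>i\<in>I. fourier (g i) r)"
  unfolding fourier_def sum_distrib_right by (rule sum.swap)

lemma fourier_cmult: "fourier (\<lambda>x. c * g x) r = c * fourier g r"
  by (simp add: fourier_def sum_distrib_left mult.assoc)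

lemma fourier_diff: "fourier (\<lambda>x. f x - g x) r = fourier f r - fourier g r"
  by (simp add: fourier_def left_diff_distrib sum_subtractf)

end

section \<open>The large spectrum and Chang's theorem\<close>

lemma exp_le_quadratic:
  fixes x :: real
  assumes "\<bar>x\<bar> \<le> 1"
  shows "exp x \<le> 1 + x + x\<^sup>2"
proof (cases "x \<ge> 0")
  case True
  then show ?thesis using assms exp_bound by simp
next
  case False
  define y where "y = - x"
  have y: "0 < y" "y \<le> 1" using False assms by (auto simp: y_def)
  \<comment> \<open>The product equals 1 + y^3.\<close>
  have "1 \<le> (1 - y + y\<^sup>2) * (1 + y)"
    using y by (simp add: algebra_simps power2_eq_square)
  also have "\<dots> \<le> (1 - y + y\<^sup>2) * exp y"
    using y by (intro mult_left_mono exp_ge_add_one_self) auto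
  finally have "exp (- y) \<le> 1 - y + y\<^sup>2"
    by (simp add: exp_minus field_simps)
  then show ?thesis by (simp add: y_def)
qed

text \<open>By convexity, exp lies below its chord over [-\<theta>, \<theta>]. The bound is affine
  in \<open>y\<close>, so a product of such factors is a trigonometric polynomial.\<close>

lemma exp_mult_le_cosh_sinh:
  fixes \<theta> y :: real
  assumes "\<bar>y\<bar> \<le> 1"
  shows "exp (\<theta> * y) \<le> cosh \<theta> + y * sinh \<theta>"
proof -
  have "exp ((1 - (1 + y) / 2) *\<^sub>R (- \<theta>) + ((1 + y) / 2) *\<^sub>R \<theta>)
      \<le> (1 - (1 + y) / 2) * exp (- \<theta>) + ((1 + y) / 2) * exp \<theta>"
    using assms by (intro convex_onD[OF exp_convex]) (auto simp: abs_le_iff)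
  moreover have "(1 - (1 + y) / 2) *\<^sub>R (- \<theta>) + ((1 + y) / 2) *\<^sub>R \<theta> = \<theta> * y"
    by (simp add: field_simps)
  moreover have "(1 - (1 + y) / 2) * exp (- \<theta>) + ((1 + y) / 2) * exp \<theta> = cosh \<theta> + y * sinh \<theta>"
    by (simp add: cosh_def sinh_def field_simps)
  ultimately show ?thesis by simp
qed

lemma cosh_le_exp_square:
  fixes \<theta> :: real
  assumes "\<bar>\<theta>\<bar> \<le> 1"
  shows "cosh \<theta> \<le> exp (\<theta>\<^sup>2)"
proof -
  have "cosh \<theta> \<le> 1 + \<theta>\<^sup>2"
    using exp_le_quadratic[of \<theta>] exp_le_quadratic[of "-\<theta>"] assms
    by (simp add: cosh_def field_simps)
  also have "\<dots> \<le> exp (\<theta>\<^sup>2)" by (rule exp_ge_add_one_self)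
  finally show ?thesis .
qed

text \<open>Jensen's inequality, from the tangent line of exp at \<open>m\<close>; a lower bound
  \<open>m\<close> for the mean suffices because exp is increasing.\<close>

lemma card_mult_exp_le_sum_exp:
  fixes Y :: "'a \<Rightarrow> real"
  assumes "finite S" "real (card S) * m \<le> (\<Sum>s\<in>S. Y s)"
  shows "real (card S) * exp m \<le> (\<Sum>s\<in>S. exp (Y s))"
proof -
  have "exp m * (1 + (Y s - m)) \<le> exp (Y s)" for s
  proof -
    have "exp m * (1 + (Y s - m)) \<le> exp m * exp (Y s - m)"
      by (intro mult_left_mono exp_ge_add_one_self) auto
    then show ?thesis by (simp add: exp_diff)
  qed
  then have "(\<Sum>s\<in>S. exp m * (1 + (Y s - m))) \<le> (\<Sum>s\<in>S. exp (Y s))"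
    by (rule sum_mono)
  moreover have "(\<Sum>s\<in>S. exp m * (1 + (Y s - m)))
      = exp m * (real (card S) + ((\<Sum>s\<in>S. Y s) - real (card S) * m))"
    by (simp add: sum_distrib_left[symmetric] sum.distrib sum_subtractf)
  moreover have "exp m * real (card S) \<le> exp m * (real (card S) + ((\<Sum>s\<in>S. Y s) - real (card S) * m))"
    using assms by (intro mult_left_mono) auto
  ultimately have "exp m * real (card S) \<le> (\<Sum>s\<in>S. exp (Y s))" by linarith
  then show ?thesis by (simp add: mult.commute)
qed

section \<open>Rudin's inequality by Riesz products, Chang's bound, and smoothing\<close>

context cyclic
begin

text \<open>The coefficients -1, 0, 1 are those that arise when a Riesz product over
  \<open>D\<close> is expanded.\<close>

definition dissociated :: "int set \<Rightarrow> bool" where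
  "dissociated D \<longleftrightarrow> (\<forall>\<epsilon>. (\<forall>d\<in>D. \<epsilon> d \<in> {-1, 0, 1}) \<and> int N dvd (\<Sum>d\<in>D. \<epsilon> d * d) \<longrightarrow> (\<forall>d\<in>D. \<epsilon> d = 0))"

text \<open>The exponential is majorised by a Riesz product. Its expansion has frequencies that are
  signed sums of \<open>D\<close>; summing over \<open>res\<close> keeps those divisible by
  \<open>N\<close>, and dissociativity leaves the constant term alone.\<close>

lemma rudin_exponential_moment:
  assumes D: "finite D" "dissociated D" and w: "\<And>d. norm (w d) = 1"
  shows "(\<Sum>x\<in>res. exp (\<theta> * (\<Sum>d\<in>D. Re (w d * ee d x)))) \<le> real N * cosh \<theta> ^ card D"
proof -
  \<comment> \<open>The Fourier coefficient, at frequency \<open>j * d\<close>, of the factor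
    belonging to \<open>d\<close>.\<close>
  define a where "a d j = (if j = 0 then of_real (cosh \<theta>)
     else if j = 1 then of_real (sinh \<theta> / 2) * w d else of_real (sinh \<theta> / 2) * cnj (w d))"
    for d j :: int
  let ?E = "PiE D (\<lambda>_. {-1, 0, 1 :: int})"
  let ?R = "\<lambda>x. \<Prod>d\<in>D. cosh \<theta> + Re (w d * ee d x) * sinh \<theta>"
  have R: "complex_of_real (?R x) = (\<Sum>\<epsilon>\<in>?E. (\<Prod>d\<in>D. a d (\<epsilon> d)) * ee (\<Sum>d\<in>D. \<epsilon> d * d) x)" for x
  proof -
    have "complex_of_real (cosh \<theta> + Re (w d * ee d x) * sinh \<theta>)
        = (\<Sum>j\<in>{-1, 0, 1}. a d j * ee (j * d) x)" for d
    proof -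
      have "complex_of_real (Re z) = (z + cnj z) / 2" for z
        by (simp add: complex_add_cnj)
      from this[of "w d * ee d x"]
      have "complex_of_real (Re (w d * ee d x)) = (w d * ee d x + cnj (w d) * ee (- d) x) / 2"
        by (simp only: ee_minus complex_cnj_mult)
      then show ?thesis by (simp only: of_real_add of_real_mult) (simp add: a_def algebra_simps add_divide_distrib)
    qed
    then have "complex_of_real (?R x) = (\<Prod>d\<in>D. \<Sum>j\<in>{-1, 0, 1}. a d j * ee (j * d) x)"
      by simp
    also have "\<dots> = (\<Sum>\<epsilon>\<in>?E. \<Prod>d\<in>D. a d (\<epsilon> d) * ee (\<epsilon> d * d) x)"
      using D by (intro prod_sum_PiE) auto
    finally show ?thesis by (simp add: prod.distrib ee_sum)
  qed
  have "complex_of_real (\<Sum>x\<in>res. ?R x)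
      = (\<Sum>x\<in>res. \<Sum>\<epsilon>\<in>?E. (\<Prod>d\<in>D. a d (\<epsilon> d)) * ee (\<Sum>d\<in>D. \<epsilon> d * d) x)"
    unfolding of_real_sum R ..
  also have "\<dots> = (\<Sum>\<epsilon>\<in>?E. (\<Prod>d\<in>D. a d (\<epsilon> d)) * (\<Sum>x\<in>res. ee (\<Sum>d\<in>D. \<epsilon> d * d) x))"
    by (subst sum.swap) (simp add: sum_distrib_left)
  also have "\<dots> = (\<Sum>\<epsilon>\<in>?E. if \<epsilon> = restrict (\<lambda>_. 0) D then complex_of_real (real N * cosh \<theta> ^ card D) else 0)"
  proof (intro sum.cong refl)
    fix \<epsilon> assume \<epsilon>: "\<epsilon> \<in> ?E"
    then have "\<forall>d\<in>D. \<epsilon> d \<in> {-1, 0, 1}" by (auto simp: PiE_iff)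
    then have "int N dvd (\<Sum>d\<in>D. \<epsilon> d * d) \<longleftrightarrow> (\<forall>d\<in>D. \<epsilon> d = 0)"
      using D(2) unfolding dissociated_def by (metis (no_types, lifting) dvd_0_right mult_zero_left sum.neutral)
    also have "\<dots> \<longleftrightarrow> \<epsilon> = restrict (\<lambda>_. 0) D"
      using \<epsilon> by (auto simp: fun_eq_iff PiE_iff extensional_def)
    finally show "(\<Prod>d\<in>D. a d (\<epsilon> d)) * (\<Sum>x\<in>res. ee (\<Sum>d\<in>D. \<epsilon> d * d) x)
        = (if \<epsilon> = restrict (\<lambda>_. 0) D then complex_of_real (real N * cosh \<theta> ^ card D) else 0)"
      by (simp add: sum_ee a_def)
  qed
  also have "\<dots> = complex_of_real (real N * cosh \<theta> ^ card D)"
    using D(1) by (subst sum.delta) (auto simp: finite_PiE PiE_iff)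
  finally have sumR: "(\<Sum>x\<in>res. ?R x) = real N * cosh \<theta> ^ card D"
    by (simp only: of_real_eq_iff)
  have "exp (\<theta> * (\<Sum>d\<in>D. Re (w d * ee d x))) \<le> ?R x" for x
  proof -
    have "exp (\<theta> * (\<Sum>d\<in>D. Re (w d * ee d x))) = (\<Prod>d\<in>D. exp (\<theta> * Re (w d * ee d x)))"
      by (simp add: sum_distrib_left exp_sum D)
    also have "\<dots> \<le> ?R x"
    proof (intro prod_mono conjI)
      fix d
      have "\<bar>Re (w d * ee d x)\<bar> \<le> 1"
        using abs_Re_le_cmod[of "w d * ee d x"] w by (simp add: norm_mult)
      then show "exp (\<theta> * Re (w d * ee d x)) \<le> cosh \<theta> + Re (w d * ee d x) * sinh \<theta>"
        by (rule exp_mult_le_cosh_sinh)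
    qed simp
    finally show ?thesis .
  qed
  then show ?thesis unfolding sumR[symmetric] by (rule sum_mono)
qed

text \<open>Level 1/2 is chosen so that one smoothing multiplies every other Fourier coefficient by
  less than 1/4.\<close>

definition spectrum :: "int set \<Rightarrow> int set" where
  "spectrum S = {r \<in> res. norm (\<Sum>s\<in>S. ee r s) \<ge> real (card S) / 2}"

text \<open>Chang's bound. After a rotation, each character in \<open>D\<close> has mean at least
  1/2 on \<open>S\<close>, so their sum has mean at least |D|/2 there. Jensen then gives a lower
  bound for the exponential moment over \<open>S\<close>, which Rudin's inequality bounds above over
  all of \<open>res\<close>.\<close>

lemma card_dissociated_spectrum:
  assumes S: "S \<subseteq> res" "S \<noteq> {}" and D: "D \<subseteq> spectrum S" "dissociated D"
  shows "real (card D) \<le> 16 * ln (real N / real (card S))"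
proof -
  have "D \<subseteq> res" using D(1) by (auto simp: spectrum_def)
  then have fin: "finite S" "finite D" using S(1) finite_subset finite_res by blast+
  have cS: "real (card S) > 0" using fin S by (simp add: card_gt_0_iff)
  \<comment> \<open>The phase that makes the character sum over \<open>S\<close> real and
    nonnegative; the value 1 keeps it unimodular when the sum vanishes.\<close>
  define w where "w d = (let z = (\<Sum>s\<in>S. ee d s) in if z = 0 then 1 else cnj z / of_real (norm z))" for d
  have "norm (if z = 0 then 1 else cnj z / of_real (norm z)) = 1" for z :: complex
    by (simp add: norm_divide)
  then have w1: "norm (w d) = 1" for d unfolding w_def Let_def by blast
  have w2: "(\<Sum>s\<in>S. Re (w d * ee d s)) \<ge> real (card S) / 2" if "d \<in> D" for d
  proof -
    define z where "z = (\<Sum>s\<in>S. ee d s)"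
    have "(\<Sum>s\<in>S. Re (w d * ee d s)) = Re (w d * z)"
      by (simp add: z_def Re_sum[symmetric] sum_distrib_left)
    also have "w d * z = of_real (norm z)"
    proof (cases "z = 0")
      case False
      then have "w d * z = cnj z * z / of_real (norm z)" by (simp add: w_def z_def Let_def)
      also have "cnj z * z = of_real (norm z) * of_real (norm z)"
        using complex_norm_square[of z] by (simp add: power2_eq_square mult.commute)
      finally show ?thesis using False by simp
    qed simp
    finally show ?thesis using that D by (auto simp: spectrum_def z_def)
  qed
  \<comment> \<open>The parameter 1/4 maximises \<theta>/2 - \<theta>^2, the gain from Jensen minus
    the cost from cosh. The maximum 1/16 yields the constant 16.\<close>
  have "real (card S) * (1/4 * (real (card D) / 2)) \<le> 1/4 * (\<Sum>d\<in>D. \<Sum>s\<in>S. Re (w d * ee d s))"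
    using sum_mono[of D "\<lambda>_. real (card S) / 2", OF w2] by (simp add: field_simps)
  also have "\<dots> = (\<Sum>s\<in>S. 1/4 * (\<Sum>d\<in>D. Re (w d * ee d s)))"
    by (subst sum.swap) (rule sum_distrib_left)
  finally have "real (card S) * exp (1/4 * (real (card D) / 2)) \<le> (\<Sum>s\<in>S. exp (1/4 * (\<Sum>d\<in>D. Re (w d * ee d s))))"
    by (rule card_mult_exp_le_sum_exp[OF fin(1)])
  also have "\<dots> \<le> (\<Sum>s\<in>res. exp (1/4 * (\<Sum>d\<in>D. Re (w d * ee d s))))"
    by (rule sum_mono2) (use S in auto)
  also have "\<dots> \<le> real N * cosh (1/4) ^ card D"
    by (rule rudin_exponential_moment[OF fin(2) D(2) w1])
  also have "\<dots> \<le> real N * exp (1/16) ^ card D"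
    using cosh_le_exp_square[of "1/4"]
    by (intro mult_left_mono power_mono) (auto simp: power2_eq_square)
  also have "\<dots> = real N * exp (real (card D) / 16)"
    by (simp add: exp_of_nat_mult[symmetric])
  finally have "exp (real (card D) / 16) * exp (real (card D) / 16) * real (card S) \<le> real N * exp (real (card D) / 16)"
    by (simp add: exp_add[symmetric] mult.commute)
  then have "exp (real (card D) / 16) \<le> real N / real (card S)"
    using cS by (simp add: field_simps)
  then have "real (card D) / 16 \<le> ln (real N / real (card S))"
    using cS N_pos by (subst ln_ge_iff) auto
  then show ?thesis by simp
qed

text \<open>For a maximal dissociated \<open>D\<close> inside the spectrum, adding any further
  \<open>r\<close> creates a relation, which expresses \<open>r\<close> modulo \<open>N\<close> as a
  signed sum of elements of \<open>D\<close>.\<close>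

lemma spectrum_cover:
  assumes S: "S \<subseteq> res" "S \<noteq> {}"
  obtains D where "D \<subseteq> res" "real (card D) \<le> 16 * ln (real N / real (card S))"
    "\<And>r x. r \<in> spectrum S \<Longrightarrow> norm (ee r x - 1) \<le> (\<Sum>d\<in>D. norm (ee d x - 1))"
proof -
  let ?F = "{D. D \<subseteq> spectrum S \<and> dissociated D}"
  have fin: "finite (spectrum S)" by (simp add: spectrum_def)
  then have "finite ?F" by simp
  moreover have "{} \<in> ?F" by (simp add: dissociated_def)
  ultimately obtain D where D: "D \<in> ?F" "\<And>D'. D' \<in> ?F \<Longrightarrow> D \<subseteq> D' \<Longrightarrow> D = D'"
    using finite_has_maximal[of ?F] by (metis (no_types, lifting) empty_iff)
  have finD: "finite D" using D fin finite_subset by auto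
  show ?thesis
  proof (rule that[of D])
    show "D \<subseteq> res" using D by (auto simp: spectrum_def)
    show "real (card D) \<le> 16 * ln (real N / real (card S))"
      using D by (intro card_dissociated_spectrum[OF S]) auto
    fix r x assume r: "r \<in> spectrum S"
    show "norm (ee r x - 1) \<le> (\<Sum>d\<in>D. norm (ee d x - 1))"
    proof (cases "r \<in> D")
      case True
      then show ?thesis using finD by (intro member_le_sum) auto
    next
      case False
      then have "\<not> dissociated (insert r D)" using D(1) D(2)[of "insert r D"] r by blast
      then obtain \<epsilon> where \<epsilon>: "\<forall>d\<in>insert r D. \<epsilon> d \<in> {-1, 0, 1}"
        "int N dvd (\<Sum>d\<in>insert r D. \<epsilon> d * d)" "\<not> (\<forall>d\<in>insert r D. \<epsilon> d = 0)"
        unfolding dissociated_def by blast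
      define t where "t = (\<Sum>d\<in>D. \<epsilon> d * d)"
      have dvd: "int N dvd \<epsilon> r * r + t" using \<epsilon>(2) False finD by (simp add: t_def)
      \<comment> \<open>Otherwise the relation would be a nontrivial one inside
        \<open>D\<close>.\<close>
      have "\<epsilon> r \<noteq> 0"
      proof
        assume "\<epsilon> r = 0"
        then have "\<forall>d\<in>D. \<epsilon> d = 0" using D(1) dvd \<epsilon>(1) unfolding dissociated_def t_def by simp
        with \<open>\<epsilon> r = 0\<close> \<epsilon>(3) show False by simp
      qed
      then have "\<epsilon> r = 1 \<or> \<epsilon> r = -1" using \<epsilon>(1) by auto
      moreover obtain k where k: "\<epsilon> r * r + t = k * int N" using dvd by (metis dvd_def mult.commute)
      have "ee (\<epsilon> r * r) x * ee t x = 1"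
        by (metis ee_add_left k ee_commute ee_mult_N)
      then have "norm (ee (\<epsilon> r * r) x - 1) = norm (ee t x - 1)"
      proof -
        assume *: "ee (\<epsilon> r * r) x * ee t x = 1"
        have "norm (ee t x - 1) = norm (ee (\<epsilon> r * r) x * (ee t x - 1))" by (simp add: norm_mult)
        also have "\<dots> = norm (1 - ee (\<epsilon> r * r) x)" using * by (simp add: algebra_simps)
        finally show ?thesis by (simp add: norm_minus_commute)
      qed
      ultimately have "norm (ee r x - 1) = norm (ee t x - 1)" by (auto simp: norm_ee_minus)
      also have "\<dots> \<le> (\<Sum>d\<in>D. norm (ee d x - 1))"
        unfolding t_def using \<epsilon>(1) by (intro norm_ee_minus_1_sum) auto
      finally show ?thesis .
    qed
  qed
qed

text \<open>Convolution with the uniform measures on \<open>S\<close> and on \<open>- S\<close>.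
  Using both makes the Fourier multiplier a squared modulus, hence real and nonnegative.\<close>

definition smooth :: "int set \<Rightarrow> (int \<Rightarrow> real) \<Rightarrow> int \<Rightarrow> real" where
  "smooth S h x = (\<Sum>s\<in>S. \<Sum>s'\<in>S. h (x + (s - s'))) / (real (card S))\<^sup>2"

lemma periodic_smooth: "periodic h \<Longrightarrow> periodic (smooth S h)"
  using periodic_shift[of h] unfolding smooth_def periodic_def by simp

lemma periodic_smooth_iter: "periodic h \<Longrightarrow> periodic ((smooth S ^^ l) h)"
  by (induction l) (simp_all add: periodic_smooth)

lemma fourier_smooth:
  assumes "periodic h"
  shows "fourier (\<lambda>x. of_real (smooth S h x)) r
    = of_real ((norm (\<Sum>s\<in>S. ee r s) / real (card S))\<^sup>2) * fourier (\<lambda>x. of_real (h x)) r"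
proof -
  have per: "periodic (\<lambda>x. complex_of_real (h x))" using assms by (simp add: periodic_def)
  let ?F = "fourier (\<lambda>x. complex_of_real (h x)) r"
  have "fourier (\<lambda>x. of_real (smooth S h x)) r
    = fourier (\<lambda>x. of_real (1 / (real (card S))\<^sup>2) * (\<Sum>s\<in>S. \<Sum>s'\<in>S. complex_of_real (h (x + (s - s'))))) r"
    unfolding smooth_def by simp
  also have "\<dots> = of_real (1 / (real (card S))\<^sup>2) * (\<Sum>s\<in>S. \<Sum>s'\<in>S. ee r (s - s') * ?F)"
    unfolding fourier_cmult fourier_sum fourier_shift[OF per] ..
  also have "(\<Sum>s\<in>S. \<Sum>s'\<in>S. ee r (s - s') * ?F) = (\<Sum>s\<in>S. ee r s) * cnj (\<Sum>s\<in>S. ee r s) * ?F"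
    by (simp only: ee_diff cnj_sum sum_product) (simp only: sum_distrib_right)
  also have "(\<Sum>s\<in>S. ee r s) * cnj (\<Sum>s\<in>S. ee r s) = of_real ((norm (\<Sum>s\<in>S. ee r s))\<^sup>2)"
    by (rule complex_norm_square[symmetric])
  finally show ?thesis by (simp add: power_divide)
qed

lemma fourier_smooth_iter:
  assumes "periodic h"
  shows "fourier (\<lambda>x. of_real ((smooth S ^^ l) h x)) r
    = of_real ((norm (\<Sum>s\<in>S. ee r s) / real (card S)) ^ (2 * l)) * fourier (\<lambda>x. of_real (h x)) r"
proof (induction l)
  case (Suc l)
  show ?case
    using fourier_smooth[where S = S and r = r, OF periodic_smooth_iter[where S = S and l = l, OF assms]] Suc
    by (simp add: power_mult power2_eq_square)
qed simp

text \<open>On the Fourier side the difference carries the factor \<open>ee r t - 1\<close> times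
  the multiplier to the power \<open>l\<close>. On the spectrum the first factor is at most \<eta>;
  off it the second is at most (1/4)^l and the first at most 2. Parseval concludes.\<close>

lemma smooth_iter_almost_period:
  assumes h: "periodic h" and S: "S \<subseteq> res" "S \<noteq> {}"
    and spec: "\<And>r. r \<in> spectrum S \<Longrightarrow> norm (ee r t - 1) \<le> \<eta>"
    and l: "2 * (1 / 4) ^ l \<le> \<eta>"
  shows "(\<Sum>x\<in>res. ((smooth S ^^ l) h (x + t) - (smooth S ^^ l) h x)\<^sup>2) \<le> \<eta>\<^sup>2 * (\<Sum>x\<in>res. (h x)\<^sup>2)"
proof -
  let ?H = "\<lambda>x. complex_of_real ((smooth S ^^ l) h x)"
  let ?m = "\<lambda>r. (norm (\<Sum>s\<in>S. ee r s) / real (card S))"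
  have per: "periodic ?H" using periodic_smooth_iter[OF h] by (simp add: periodic_def)
  have fin: "finite S" using S finite_subset[of _ res] by auto
  have cS: "real (card S) > 0" using fin S by (simp add: card_gt_0_iff)
  have \<eta>: "\<eta> \<ge> 0" using l by (rule order_trans[rotated]) simp
  have m1: "?m r \<le> 1" for r
    using norm_sum[of "ee r" S] cS by (simp add: field_simps)
  have mult: "?m r ^ (2 * l) * norm (ee r t - 1) \<le> \<eta>" if "r \<in> res" for r
  proof (cases "r \<in> spectrum S")
    case True
    have "?m r ^ (2 * l) * norm (ee r t - 1) \<le> 1 * norm (ee r t - 1)"
      using m1[of r] by (intro mult_right_mono power_le_one) auto
    then show ?thesis using spec[OF True] by simp
  next
    case False
    then have "?m r \<le> 1 / 2" using that cS by (auto simp: spectrum_def field_simps)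
    then have "?m r ^ (2 * l) \<le> (1 / 2) ^ (2 * l)" by (intro power_mono) auto
    also have "\<dots> = (1 / 4) ^ l" by (simp add: power_mult power2_eq_square)
    finally have "?m r ^ (2 * l) * norm (ee r t - 1) \<le> (1 / 4) ^ l * 2"
      using norm_triangle_ineq4[of "ee r t" 1] by (intro mult_mono) auto
    then show ?thesis using l by simp
  qed
  have "real N * (\<Sum>x\<in>res. ((smooth S ^^ l) h (x + t) - (smooth S ^^ l) h x)\<^sup>2)
      = real N * (\<Sum>x\<in>res. (norm (?H (x + t) - ?H x))\<^sup>2)"
    by (simp add: of_real_diff[symmetric] del: of_real_diff)
  also have "\<dots> = (\<Sum>r\<in>res. (norm (fourier (\<lambda>x. ?H (x + t) - ?H x) r))\<^sup>2)"
    by (rule parseval[symmetric])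
  also have "\<dots> = (\<Sum>r\<in>res. (?m r ^ (2 * l) * norm (ee r t - 1) * norm (fourier (\<lambda>x. of_real (h x)) r))\<^sup>2)"
  proof (intro sum.cong refl)
    fix r
    have "fourier (\<lambda>x. ?H (x + t) - ?H x) r = (ee r t - 1) * fourier ?H r"
      unfolding fourier_diff fourier_shift[OF per] by (simp add: algebra_simps)
    also have "\<dots> = (ee r t - 1) * (of_real (?m r ^ (2 * l)) * fourier (\<lambda>x. of_real (h x)) r)"
      unfolding fourier_smooth_iter[OF h] ..
    finally show "(norm (fourier (\<lambda>x. ?H (x + t) - ?H x) r))\<^sup>2
        = (?m r ^ (2 * l) * norm (ee r t - 1) * norm (fourier (\<lambda>x. of_real (h x)) r))\<^sup>2"
      by (simp add: norm_mult norm_power norm_divide mult_ac del: of_real_power of_real_divide)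
  qed
  also have "\<dots> \<le> (\<Sum>r\<in>res. (\<eta> * norm (fourier (\<lambda>x. of_real (h x)) r))\<^sup>2)"
    using mult by (intro sum_mono power_mono mult_right_mono) auto
  also have "\<dots> = \<eta>\<^sup>2 * (real N * (\<Sum>x\<in>res. (h x)\<^sup>2))"
    using parseval[of "\<lambda>x. of_real (h x)"] by (simp add: power_mult_distrib sum_distrib_left[symmetric])
  finally show ?thesis using N_pos by simp
qed

end

section \<open>Random sampling\<close>

text \<open>The tuples in \<open>PiE\<close> are \<open>k\<close> independent uniform draws with
  replacement, so the moment factorises. The exponent is proportional to \<open>p\<close> because a
  variable with values 0 and 1 has variance at most its mean.\<close>

lemma sum_PiE_exp_centered_le:
  fixes Z :: "'b \<Rightarrow> real"
  assumes B: "finite B" "B \<noteq> {}" and Z: "\<And>b. b \<in> B \<Longrightarrow> Z b \<in> {0, 1}"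
    and p: "p = (\<Sum>b\<in>B. Z b) / real (card B)" and \<theta>: "\<bar>\<theta>\<bar> \<le> 1"
  shows "(\<Sum>b\<in>PiE {..<k} (\<lambda>_. B). exp (\<theta> * ((\<Sum>i<k. Z (b i)) - real k * p)))
    \<le> real (card B) ^ k * exp (real k * p * \<theta>\<^sup>2)"
proof -
  have cB: "real (card B) > 0" using B by (simp add: card_gt_0_iff)
  have p0: "p \<ge> 0" unfolding p using Z by (intro divide_nonneg_nonneg sum_nonneg) force+
  have "(\<Sum>b\<in>B. exp (\<theta> * Z b)) = (\<Sum>b\<in>B. 1 + Z b * (exp \<theta> - 1))"
    using Z by (intro sum.cong refl) force
  also have "\<dots> = real (card B) + (\<Sum>b\<in>B. Z b) * (exp \<theta> - 1)"
    by (simp only: sum.distrib sum_distrib_right[symmetric]) simp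
  also have "\<dots> = real (card B) * (1 + p * (exp \<theta> - 1))"
    using cB by (simp add: p ring_distribs)
  also have "\<dots> \<le> real (card B) * exp (p * (exp \<theta> - 1))"
    using cB by (intro mult_left_mono exp_ge_add_one_self) auto
  also have "\<dots> \<le> real (card B) * exp (p * (\<theta> + \<theta>\<^sup>2))"
    using cB p0 exp_le_quadratic[OF \<theta>] by (intro mult_left_mono) (auto intro!: mult_left_mono)
  finally have one: "(\<Sum>b\<in>B. exp (\<theta> * Z b)) \<le> real (card B) * exp (p * (\<theta> + \<theta>\<^sup>2))" .
  have "(\<Sum>b\<in>PiE {..<k} (\<lambda>_. B). exp (\<theta> * ((\<Sum>i<k. Z (b i)) - real k * p)))
      = exp (- (\<theta> * real k * p)) * (\<Sum>b\<in>PiE {..<k} (\<lambda>_. B). \<Prod>i<k. exp (\<theta> * Z (b i)))"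
    by (simp add: sum_distrib_left exp_sum[symmetric] exp_add[symmetric] algebra_simps)
  also have "(\<Sum>b\<in>PiE {..<k} (\<lambda>_. B). \<Prod>i<k. exp (\<theta> * Z (b i))) = (\<Sum>b\<in>B. exp (\<theta> * Z b)) ^ k"
    using prod_sum_PiE[of "{..<k}" "\<lambda>_. B" "\<lambda>_ b. exp (\<theta> * Z b)"] B by simp
  also have "exp (- (\<theta> * real k * p)) * (\<Sum>b\<in>B. exp (\<theta> * Z b)) ^ k
      \<le> exp (- (\<theta> * real k * p)) * (real (card B) * exp (p * (\<theta> + \<theta>\<^sup>2))) ^ k"
    using one by (intro mult_left_mono power_mono sum_nonneg) auto
  also have "\<dots> = real (card B) ^ k * exp (real k * p * \<theta>\<^sup>2)"
    by (simp add: power_mult_distrib exp_of_nat_mult[symmetric] exp_add[symmetric] algebra_simps)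
  finally show ?thesis .
qed

text \<open>The deviation is measured relative to \<open>p + a\<close>, so that the number of samples needed is linear
  in 1 / a rather than quadratic.\<close>

lemma relative_chernoff:
  fixes Z :: "'b \<Rightarrow> real"
  assumes B: "finite B" "B \<noteq> {}" and Z: "\<And>b. b \<in> B \<Longrightarrow> Z b \<in> {0, 1}"
    and p: "p = (\<Sum>b\<in>B. Z b) / real (card B)" and \<delta>: "0 < \<delta>" "\<delta> \<le> 1" and a: "0 < a"
  shows "real (card {b \<in> PiE {..<k} (\<lambda>_. B). \<bar>(\<Sum>i<k. Z (b i)) - real k * p\<bar> > real k * (\<delta> * (p + a))})
    \<le> 2 * exp (- (real k * \<delta>\<^sup>2 * a / 4)) * real (card B) ^ k"
proof -
  let ?E = "PiE {..<k} (\<lambda>_. B)" and ?X = "\<lambda>b. (\<Sum>i<k. Z (b i)) - real k * p"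
  let ?bad = "{b \<in> ?E. \<bar>?X b\<bar> > real k * (\<delta> * (p + a))}"
  have finE: "finite ?E" using B by (intro finite_PiE) auto
  have p0: "p \<ge> 0" unfolding p using Z by (intro divide_nonneg_nonneg sum_nonneg) force+
  have "real (card ?bad) * exp (real k * \<delta>\<^sup>2 * (p + a) / 2)
      = (\<Sum>b\<in>?bad. exp (real k * \<delta>\<^sup>2 * (p + a) / 2))" by simp
  \<comment> \<open>Two-sided exponential Markov bound with parameter \<delta>/2: per sample the
    threshold gains \<delta>^2 (p + a)/2 while the moment costs \<delta>^2 p/4, which leaves at
    least \<delta>^2 a/4.\<close>
  also have "\<dots> \<le> (\<Sum>b\<in>?bad. exp (\<delta> / 2 * ?X b) + exp (- (\<delta> / 2) * ?X b))"
  proof (rule sum_mono)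
    fix b assume "b \<in> ?bad"
    then have "\<delta> / 2 * (real k * (\<delta> * (p + a))) \<le> \<delta> / 2 * \<bar>?X b\<bar>"
      using \<delta> by (intro mult_left_mono) auto
    then have "real k * \<delta>\<^sup>2 * (p + a) / 2 \<le> \<delta> / 2 * \<bar>?X b\<bar>"
      by (simp add: power2_eq_square mult_ac)
    then have "exp (real k * \<delta>\<^sup>2 * (p + a) / 2) \<le> exp (\<delta> / 2 * \<bar>?X b\<bar>)" by simp
    also have "\<dots> \<le> exp (\<delta> / 2 * ?X b) + exp (- (\<delta> / 2) * ?X b)"
    proof (cases "?X b \<ge> 0")
      case False
      then have "\<bar>?X b\<bar> = - ?X b" by linarith
      then have "\<delta> / 2 * \<bar>?X b\<bar> = - (\<delta> / 2) * ?X b"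
        by (simp only: mult_minus_left mult_minus_right)
      then show ?thesis by (simp only:) simp
    qed simp
    finally show "exp (real k * \<delta>\<^sup>2 * (p + a) / 2) \<le> exp (\<delta> / 2 * ?X b) + exp (- (\<delta> / 2) * ?X b)" .
  qed
  also have "\<dots> \<le> (\<Sum>b\<in>?E. exp (\<delta> / 2 * ?X b) + exp (- (\<delta> / 2) * ?X b))"
    using finE by (intro sum_mono2) (auto intro: add_nonneg_nonneg)
  also have "\<dots> \<le> real (card B) ^ k * exp (real k * p * (\<delta> / 2)\<^sup>2) + real (card B) ^ k * exp (real k * p * (- (\<delta> / 2))\<^sup>2)"
    unfolding sum.distrib using \<delta> B
    by (intro add_mono sum_PiE_exp_centered_le[OF B Z p]) auto
  also have "\<dots> = 2 * real (card B) ^ k * exp (real k * p * (\<delta> / 2)\<^sup>2)" by simp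
  finally have "real (card ?bad) * exp (real k * \<delta>\<^sup>2 * (p + a) / 2)
      \<le> 2 * real (card B) ^ k * exp (real k * p * (\<delta> / 2)\<^sup>2)" .
  then have "real (card ?bad) \<le> 2 * real (card B) ^ k * (exp (real k * p * (\<delta> / 2)\<^sup>2) / exp (real k * \<delta>\<^sup>2 * (p + a) / 2))"
    by (simp add: field_simps)
  also have "\<dots> = 2 * real (card B) ^ k * exp (real k * p * (\<delta> / 2)\<^sup>2 - real k * \<delta>\<^sup>2 * (p + a) / 2)"
    by (simp add: exp_diff)
  also have "\<dots> \<le> 2 * real (card B) ^ k * exp (- (real k * \<delta>\<^sup>2 * a / 4))"
  proof -
    have "real k * p * (\<delta> / 2)\<^sup>2 - real k * \<delta>\<^sup>2 * (p + a) / 2 = - (real k * \<delta>\<^sup>2 * a / 4) - real k * \<delta>\<^sup>2 * (p + a) / 4"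
      by (simp add: power2_eq_square field_simps)
    moreover have "real k * \<delta>\<^sup>2 * (p + a) / 4 \<ge> 0" using p0 a by simp
    ultimately show ?thesis by (intro mult_left_mono) auto
  qed
  finally show ?thesis by (simp add: mult_ac)
qed

lemma half_card_le_card_small:
  fixes c :: "'b \<Rightarrow> real"
  assumes E: "finite E" and c: "\<And>e. e \<in> E \<Longrightarrow> c e \<ge> 0" and s: "(\<Sum>e\<in>E. c e) \<le> m * real (card E)" and m: "m > 0"
  shows "real (card {e \<in> E. c e \<le> 2 * m}) \<ge> real (card E) / 2"
proof -
  let ?G = "{e \<in> E. c e \<le> 2 * m}" and ?H = "{e \<in> E. c e > 2 * m}"
  have "real (card ?H) * (2 * m) = (\<Sum>e\<in>?H. 2 * m)" by simp
  also have "\<dots> \<le> (\<Sum>e\<in>?H. c e)" by (intro sum_mono) auto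
  also have "\<dots> \<le> (\<Sum>e\<in>E. c e)" using E c by (intro sum_mono2) auto
  finally have "real (card ?H) * (2 * m) \<le> m * real (card E)" using s by linarith
  then have "real (card ?H) \<le> real (card E) / 2" using m by (simp add: field_simps)
  moreover have "card E = card ?G + card ?H"
    using E by (subst card_Un_disjoint[symmetric]) (auto intro!: arg_cong[where f = card])
  ultimately show ?thesis by simp
qed

text \<open>The quotient of the two arguments of ln is (g + a)/(f + a) = 1 + x with |x| at most
  \<delta>, and |ln(1 + x)| is at most |x| + 2 x^2, hence at most 2 |x|.\<close>

lemma abs_ln_diff_le:
  fixes f g a \<delta> :: real
  assumes "f \<ge> 0" "g \<ge> 0" "a > 0" "0 < \<delta>" "\<delta> \<le> 1 / 2" "\<bar>g - f\<bar> \<le> \<delta> * (f + a)"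
  shows "\<bar>ln (1 + g / a) - ln (1 + f / a)\<bar> \<le> 2 * \<delta>"
proof -
  define x where "x = (g - f) / (f + a)"
  have fa: "f + a > 0" using assms by linarith
  have x: "\<bar>x\<bar> \<le> \<delta>" using assms fa by (simp add: x_def field_simps abs_le_iff)
  have "ln (1 + g / a) - ln (1 + f / a) = ln ((1 + g / a) / (1 + f / a))"
    using assms by (intro ln_divide_pos[symmetric] add_pos_nonneg) auto
  also have "(1 + g / a) / (1 + f / a) = ((g + a) / a) / ((f + a) / a)"
    using assms by (simp add: add_divide_distrib add.commute)
  also have "\<dots> = (g + a) / (f + a)" using assms by simp
  also have "\<dots> = 1 + x" using fa by (simp add: x_def divide_simps)
  finally have "\<bar>ln (1 + g / a) - ln (1 + f / a)\<bar> \<le> \<bar>ln (1 + x) - x\<bar> + \<bar>x\<bar>" by simp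
  also have "\<bar>ln (1 + x) - x\<bar> \<le> 2 * x\<^sup>2"
    using x assms by (intro abs_ln_one_plus_x_minus_x_bound) auto
  also have "2 * x\<^sup>2 \<le> \<bar>x\<bar>"
  proof -
    have "2 * x\<^sup>2 = (2 * \<bar>x\<bar>) * \<bar>x\<bar>" by (simp add: power2_eq_square)
    also have "\<dots> \<le> 1 * \<bar>x\<bar>" using x assms by (intro mult_right_mono) auto
    finally show ?thesis by simp
  qed
  finally show ?thesis using x by simp
qed

section \<open>One function approximated by many translates of another\<close>

context cyclic
begin

text \<open>At least half of the \<open>k\<close>-tuples from \<open>B\<close> give good samples.
  Pairing them with all shifts gives at least |B|^k N/2 pairs but only N^k possible shifted tuples,
  so some tuple \<open>u\<close> arises from many pairs; \<open>S\<close> collects their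
  shifts.\<close>

lemma sampling_translates:
  fixes \<phi> :: "int \<Rightarrow> real" and k :: nat
  assumes \<phi>: "periodic \<phi>" "\<And>x. \<phi> x \<in> {0, 1}" and B: "B \<subseteq> res" "B \<noteq> {}"
    and f: "\<And>x. f x = (\<Sum>b\<in>B. \<phi> (x - b)) / real (card B)"
    and \<delta>: "0 < \<delta>" "\<delta> \<le> 1 / 2" and a: "0 < a" and k: "k > 0"
  obtains S g where "S \<subseteq> res" "real (card S) \<ge> (real (card B) / real N) ^ k * real N / 2"
    "periodic g" "\<And>x. 0 \<le> g x \<and> g x \<le> ln (1 + 1 / a)"
    "\<And>s. s \<in> S \<Longrightarrow> real (card {x \<in> res. \<bar>g (x + s) - ln (1 + f x / a)\<bar> > 2 * \<delta>})
      \<le> 4 * exp (- (real k * \<delta>\<^sup>2 * a / 4)) * real N"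
proof -
  define \<kappa> where "\<kappa> = exp (- (real k * \<delta>\<^sup>2 * a / 4))"
  have finB: "finite B" using B finite_subset finite_res by blast
  let ?E = "PiE {..<k} (\<lambda>_. B)"
  have finE: "finite ?E" using finB by (intro finite_PiE) auto
  have cE: "card ?E = card B ^ k" by (simp add: card_PiE)
  let ?P = "\<lambda>b x. \<bar>(\<Sum>i<k. \<phi> (x - b i)) - real k * f x\<bar> > real k * (\<delta> * (f x + a))"
  define bad where "bad b = {x \<in> res. ?P b x}" for b
  \<comment> \<open>Twice the mean number of bad points as bounded by Chernoff, so that Markov keeps
    half of the tuples.\<close>
  define good where "good = {b \<in> ?E. real (card (bad b)) \<le> 2 * (2 * \<kappa> * real N)}"
  have "(\<Sum>b\<in>?E. real (card (bad b))) = (\<Sum>b\<in>?E. \<Sum>x\<in>res. if ?P b x then 1 else 0)"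
    by (simp add: bad_def sum.If_cases Int_def)
  also have "\<dots> = (\<Sum>x\<in>res. \<Sum>b\<in>?E. if ?P b x then 1 else 0)" by (rule sum.swap)
  also have "\<dots> = (\<Sum>x\<in>res. real (card {b \<in> ?E. ?P b x}))"
    using finE by (simp add: sum.If_cases Int_def)
  also have "\<dots> \<le> (\<Sum>x\<in>res. 2 * \<kappa> * real (card B) ^ k)"
    unfolding \<kappa>_def using \<delta> by (intro sum_mono relative_chernoff finB B a f \<phi>) auto
  finally have "real (card good) \<ge> real (card ?E) / 2"
    unfolding good_def using finE N_pos cE
    by (intro half_card_le_card_small) (auto simp: \<kappa>_def mult_ac)
  then have cgood: "real (card good) \<ge> real (card B) ^ k / 2" by (simp add: cE)
  have good_fin: "finite good" using finE by (simp add: good_def)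
  let ?T = "PiE {..<k} (\<lambda>_. res)"
  define shift where "shift = (\<lambda>(b, s). restrict (\<lambda>i. (b i + s) mod int N) {..<k})"
  have "res \<noteq> {}" using N_pos by (auto simp: res_def)
  then have "?T \<noteq> {}" by (simp add: PiE_eq_empty_iff)
  moreover have "shift \<in> good \<times> res \<rightarrow> ?T"
    by (rule funcsetI) (simp add: shift_def split_beta restrict_PiE_iff del: restrict_apply)
  moreover have "finite ?T" by (intro finite_PiE) auto
  ultimately obtain u where u: "u \<in> ?T" and
    cu: "card (shift -` {u} \<inter> good \<times> res) * card ?T \<ge> card (good \<times> res)"
    using pigeonhole_card[of shift "good \<times> res" ?T] good_fin by auto
  define F where "F = shift -` {u} \<inter> good \<times> res"
  \<comment> \<open>On the fibre over \<open>u\<close> the shift determines the tuple as u - s, so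
    the fibre yields as many distinct shifts as it has pairs.\<close>
  have inj: "inj_on snd F"
  proof (rule inj_onI)
    fix v v' assume v: "v \<in> F" "v' \<in> F" "snd v = snd v'"
    define b s b' where "b = fst v" and "s = snd v" and "b' = fst v'"
    have vs: "v = (b, s)" "v' = (b', s)" using v(3) by (simp_all add: prod_eq_iff b_def s_def b'_def)
    have b: "shift (b, s) = u" "b \<in> good" "shift (b', s) = u" "b' \<in> good"
      using v(1,2) by (auto simp: F_def vs)
    have "b = b'"
    proof (rule PiE_ext)
      show bb: "b \<in> ?E" "b' \<in> ?E" using b by (auto simp: good_def)
      fix i assume i: "i \<in> {..<k}"
      then have "(b i + s) mod int N = (b' i + s) mod int N"
        using b by (auto simp: shift_def fun_eq_iff split: if_splits)
      then have "b i mod int N = b' i mod int N"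
        by (metis add_diff_cancel_right' mod_diff_left_eq)
      moreover have "b i \<in> res" "b' i \<in> res" using bb i B by (auto simp: PiE_iff)
      ultimately show "b i = b' i" by (simp add: mod_res_id)
    qed
    then show "v = v'" by (simp add: vs)
  qed
  define S where "S = snd ` F"
  \<comment> \<open>Built from \<open>u\<close> alone, hence common to all shifts: since
    \<open>u\<close> is b + s modulo \<open>N\<close>, sampling at \<open>u\<close> from x + s is
    sampling at \<open>b\<close> from x.\<close>
  define g where "g x = ln (1 + ((\<Sum>i<k. \<phi> (x - u i)) / real k) / a)" for x
  have avg: "0 \<le> (\<Sum>i<k. \<phi> (x - v i)) / real k \<and> (\<Sum>i<k. \<phi> (x - v i)) / real k \<le> 1" for x v
  proof -
    have "0 \<le> (\<Sum>i<k. \<phi> (x - v i))" using \<phi>(2) by (intro sum_nonneg) (metis insertE order_refl singletonD zero_le_one)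
    moreover have "(\<Sum>i<k. \<phi> (x - v i)) \<le> (\<Sum>i<k. 1)"
      using \<phi>(2) by (intro sum_mono) (metis insertE order_refl singletonD zero_le_one)
    ultimately show ?thesis using k by (simp add: field_simps)
  qed
  show ?thesis
  proof (rule that[of S g])
    show "S \<subseteq> res" by (auto simp: S_def F_def)
    have "real (card F) * real N ^ k \<ge> real (card good) * real N"
      using cu unfolding F_def[symmetric] by (simp add: card_cartesian_product card_PiE flip: of_nat_mult of_nat_power)
    moreover have "real (card good) * real N \<ge> real (card B) ^ k / 2 * real N"
      using cgood by (intro mult_right_mono) auto
    ultimately have "real (card F) * real N ^ k \<ge> real (card B) ^ k / 2 * real N" by linarith
    then show "real (card S) \<ge> (real (card B) / real N) ^ k * real N / 2"
      using N_pos by (simp add: S_def card_image[OF inj] field_simps)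
    show "periodic g"
    proof (rule periodicI)
      fix x j
      have "\<phi> (x + j * int N - u i) = \<phi> (x - u i)" for i
        using periodic_add_mult[OF \<phi>(1), of "x - u i" j] by (simp add: algebra_simps)
      then show "g (x + j * int N) = g x" by (simp add: g_def)
    qed
    show "0 \<le> g x \<and> g x \<le> ln (1 + 1 / a)" for x
    proof -
      define v where "v = (\<Sum>i<k. \<phi> (x - u i)) / real k"
      have v: "0 \<le> v" "v \<le> 1" using avg[of x u] by (simp_all add: v_def)
      have "0 \<le> ln (1 + v / a)" using v a by simp
      moreover have "ln (1 + v / a) \<le> ln (1 + 1 / a)"
        using v a by (intro ln_mono add_left_mono divide_right_mono add_pos_nonneg) auto
      ultimately show ?thesis by (simp add: g_def v_def)
    qed
    fix s assume "s \<in> S"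
    then obtain b where b: "b \<in> good" "shift (b, s) = u" by (auto simp: S_def F_def)
    have eq: "(\<Sum>i<k. \<phi> (x + s - u i)) = (\<Sum>i<k. \<phi> (x - b i))" for x
    proof (intro sum.cong refl)
      fix i assume "i \<in> {..<k}"
      then have "u i = (b i + s) mod int N" using b(2) by (auto simp: shift_def)
      then have "(x + s - u i) mod int N = (x + s - (b i + s)) mod int N" by (simp add: mod_simps)
      then show "\<phi> (x + s - u i) = \<phi> (x - b i)" by (intro periodicD[OF \<phi>(1)]) simp
    qed
    have f0: "f x \<ge> 0" for x unfolding f using \<phi>(2)
      by (intro divide_nonneg_nonneg sum_nonneg) (auto, metis insertE order_refl singletonD zero_le_one)
    have "{x \<in> res. \<bar>g (x + s) - ln (1 + f x / a)\<bar> > 2 * \<delta>} \<subseteq> bad b"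
    proof
      fix x assume x: "x \<in> {x \<in> res. \<bar>g (x + s) - ln (1 + f x / a)\<bar> > 2 * \<delta>}"
      have "\<not> \<bar>(\<Sum>i<k. \<phi> (x - b i)) / real k - f x\<bar> \<le> \<delta> * (f x + a)"
        using abs_ln_diff_le[OF f0[of x] conjunct1[OF avg[of x b]] a \<delta>] x by (auto simp: g_def eq)
      moreover have "\<bar>(\<Sum>i<k. \<phi> (x - b i)) - real k * f x\<bar> = real k * \<bar>(\<Sum>i<k. \<phi> (x - b i)) / real k - f x\<bar>"
      proof -
        have "(\<Sum>i<k. \<phi> (x - b i)) - real k * f x = real k * ((\<Sum>i<k. \<phi> (x - b i)) / real k - f x)"
          using k by (simp add: right_diff_distrib)
        then show ?thesis by (simp only: abs_mult abs_of_nat)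
      qed
      ultimately have "?P b x" using k by (simp add: mult_le_cancel_left)
      then show "x \<in> bad b" using x by (simp add: bad_def)
    qed
    then have "card {x \<in> res. \<bar>g (x + s) - ln (1 + f x / a)\<bar> > 2 * \<delta>} \<le> card (bad b)"
      by (intro card_mono) (auto simp: bad_def)
    also have "real (card (bad b)) \<le> 4 * \<kappa> * real N" using b(1) by (simp add: good_def)
    finally show "real (card {x \<in> res. \<bar>g (x + s) - ln (1 + f x / a)\<bar> > 2 * \<delta>})
      \<le> 4 * exp (- (real k * \<delta>\<^sup>2 * a / 4)) * real N" by (simp add: \<kappa>_def)
  qed
qed

section \<open>Almost periods\<close>

text \<open>The norm dual to the probability densities bounded by \<open>M\<close> times the uniform one; being
  translation invariant, it lets almost periods be added.\<close>

definition small :: "real \<Rightarrow> (int \<Rightarrow> real) \<Rightarrow> real \<Rightarrow> bool" where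
  "small M h \<delta> \<longleftrightarrow> (\<forall>\<nu>. periodic \<nu> \<and> (\<forall>x. 0 \<le> \<nu> x \<and> \<nu> x \<le> M / real N) \<and> (\<Sum>x\<in>res. \<nu> x) \<le> 1
     \<longrightarrow> (\<Sum>x\<in>res. \<nu> x * \<bar>h x\<bar>) \<le> \<delta>)"

lemma small_shift:
  assumes "periodic h" "small M h \<delta>"
  shows "small M (\<lambda>x. h (x + t)) \<delta>"
  unfolding small_def
proof (intro allI impI, elim conjE)
  fix \<nu> :: "int \<Rightarrow> real"
  assume \<nu>: "periodic \<nu>" "\<forall>x. 0 \<le> \<nu> x \<and> \<nu> x \<le> M / real N" "(\<Sum>x\<in>res. \<nu> x) \<le> 1"
  define \<mu> where "\<mu> x = \<nu> (x + - t)" for x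
  have \<mu>: "periodic \<mu>" "(\<Sum>x\<in>res. \<mu> x) = (\<Sum>x\<in>res. \<nu> x)"
    unfolding \<mu>_def by (rule periodic_shift[OF \<nu>(1)], rule sum_periodic_shift[OF \<nu>(1)])
  have "periodic (\<lambda>x. \<mu> x * \<bar>h x\<bar>)" using \<mu>(1) assms(1) by (simp add: periodic_def)
  from sum_periodic_shift[OF this, of t]
  have "(\<Sum>x\<in>res. \<nu> x * \<bar>h (x + t)\<bar>) = (\<Sum>x\<in>res. \<mu> x * \<bar>h x\<bar>)" by (simp add: \<mu>_def)
  also have "\<dots> \<le> \<delta>"
  proof -
    have "\<forall>x. 0 \<le> \<mu> x \<and> \<mu> x \<le> M / real N" using \<nu> by (simp add: \<mu>_def)
    then show ?thesis using assms(2) \<mu> \<nu> unfolding small_def by auto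
  qed
  finally show "(\<Sum>x\<in>res. \<nu> x * \<bar>h (x + t)\<bar>) \<le> \<delta>" .
qed

lemma small_triangle:
  assumes "small M h1 \<delta>1" "small M h2 \<delta>2" "\<And>x. \<bar>h x\<bar> \<le> \<bar>h1 x\<bar> + \<bar>h2 x\<bar>"
  shows "small M h (\<delta>1 + \<delta>2)"
  unfolding small_def
proof (intro allI impI)
  fix \<nu> :: "int \<Rightarrow> real"
  assume \<nu>: "periodic \<nu> \<and> (\<forall>x. 0 \<le> \<nu> x \<and> \<nu> x \<le> M / real N) \<and> (\<Sum>x\<in>res. \<nu> x) \<le> 1"
  have "(\<Sum>x\<in>res. \<nu> x * \<bar>h x\<bar>) \<le> (\<Sum>x\<in>res. \<nu> x * (\<bar>h1 x\<bar> + \<bar>h2 x\<bar>))"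
    using \<nu> assms(3) by (intro sum_mono mult_left_mono) auto
  also have "\<dots> \<le> \<delta>1 + \<delta>2"
    using assms(1,2) \<nu> by (simp add: small_def ring_distribs sum.distrib add_mono)
  finally show "(\<Sum>x\<in>res. \<nu> x * \<bar>h x\<bar>) \<le> \<delta>1 + \<delta>2" .
qed

lemma small_zero: "0 \<le> \<delta> \<Longrightarrow> small M (\<lambda>_. 0) \<delta>"
  by (simp add: small_def)

lemma small_average:
  assumes "finite I" "I \<noteq> {}" "\<And>i. i \<in> I \<Longrightarrow> small M (F i) \<delta>"
  shows "small M (\<lambda>x. (\<Sum>i\<in>I. F i x) / real (card I)) \<delta>"
  unfolding small_def
proof (intro allI impI)
  fix \<nu> :: "int \<Rightarrow> real"
  assume \<nu>: "periodic \<nu> \<and> (\<forall>x. 0 \<le> \<nu> x \<and> \<nu> x \<le> M / real N) \<and> (\<Sum>x\<in>res. \<nu> x) \<le> 1"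
  have cI: "real (card I) > 0" using assms by (simp add: card_gt_0_iff)
  have "(\<Sum>x\<in>res. \<nu> x * \<bar>(\<Sum>i\<in>I. F i x) / real (card I)\<bar>)
      \<le> (\<Sum>x\<in>res. \<nu> x * ((\<Sum>i\<in>I. \<bar>F i x\<bar>) / real (card I)))"
    using \<nu> cI by (intro sum_mono mult_left_mono) (auto intro!: divide_right_mono sum_abs)
  also have "\<dots> = (\<Sum>i\<in>I. \<Sum>x\<in>res. \<nu> x * \<bar>F i x\<bar>) / real (card I)"
    by (subst sum.swap) (simp add: sum_distrib_left sum_divide_distrib)
  also have "\<dots> \<le> (\<Sum>i\<in>I. \<delta>) / real (card I)"
    using \<nu> assms(3) cI by (intro divide_right_mono sum_mono) (auto simp: small_def)
  also have "\<dots> = \<delta>" using cI by simp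
  finally show "(\<Sum>x\<in>res. \<nu> x * \<bar>(\<Sum>i\<in>I. F i x) / real (card I)\<bar>) \<le> \<delta>" .
qed

text \<open>A density of height M/N gives mass at most M \<epsilon> to the exceptional set, where
  |h| is at most \<open>W\<close>.\<close>

lemma small_except:
  assumes W: "\<And>x. \<bar>h x\<bar> \<le> W" and \<eta>: "\<eta> \<ge> 0" and M: "M \<ge> 0"
    and c: "real (card {x \<in> res. \<bar>h x\<bar> > \<eta>}) \<le> \<epsilon> * real N"
  shows "small M h (\<eta> + W * M * \<epsilon>)"
  unfolding small_def
proof (intro allI impI)
  fix \<nu> :: "int \<Rightarrow> real"
  assume \<nu>: "periodic \<nu> \<and> (\<forall>x. 0 \<le> \<nu> x \<and> \<nu> x \<le> M / real N) \<and> (\<Sum>x\<in>res. \<nu> x) \<le> 1"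
  have W0: "W \<ge> 0" using W[of 0] by linarith
  have "(\<Sum>x\<in>res. \<nu> x * \<bar>h x\<bar>) \<le> (\<Sum>x\<in>res. \<nu> x * \<eta> + (if \<bar>h x\<bar> > \<eta> then M / real N * W else 0))"
  proof (rule sum_mono)
    fix x
    show "\<nu> x * \<bar>h x\<bar> \<le> \<nu> x * \<eta> + (if \<bar>h x\<bar> > \<eta> then M / real N * W else 0)"
    proof (cases "\<bar>h x\<bar> > \<eta>")
      case True
      have "\<nu> x * \<bar>h x\<bar> \<le> M / real N * W" using \<nu> W by (intro mult_mono) (auto intro: order_trans)
      moreover have "\<nu> x * \<eta> \<ge> 0" using \<nu> \<eta> by simp
      ultimately show ?thesis using True by simp
    next
      case False
      then show ?thesis using \<nu> by (auto intro: mult_left_mono)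
    qed
  qed
  also have "\<dots> = (\<Sum>x\<in>res. \<nu> x) * \<eta> + real (card {x \<in> res. \<bar>h x\<bar> > \<eta>}) * (M / real N * W)"
    by (simp add: sum.distrib sum_distrib_right sum.If_cases Int_def)
  also have "\<dots> \<le> 1 * \<eta> + (\<epsilon> * real N) * (M / real N * W)"
    using \<nu> c M W0 \<eta> by (intro add_mono mult_right_mono) auto
  also have "\<dots> = \<eta> + W * M * \<epsilon>" using N_pos by simp
  finally show "(\<Sum>x\<in>res. \<nu> x * \<bar>h x\<bar>) \<le> \<eta> + W * M * \<epsilon>" .
qed

text \<open>Cauchy-Schwarz, where the sum of squares of a density is at most its height M/N. This is
  the bridge from Parseval to \<open>small\<close>, at the price of sqrt M.\<close>

lemma small_of_sum_square:
  assumes M: "M \<ge> 0" and V: "(\<Sum>x\<in>res. (h x)\<^sup>2) \<le> V * real N"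
  shows "small M h (sqrt (M * V))"
  unfolding small_def
proof (intro allI impI)
  fix \<nu> :: "int \<Rightarrow> real"
  assume \<nu>: "periodic \<nu> \<and> (\<forall>x. 0 \<le> \<nu> x \<and> \<nu> x \<le> M / real N) \<and> (\<Sum>x\<in>res. \<nu> x) \<le> 1"
  have "(\<Sum>x\<in>res. \<nu> x * \<bar>h x\<bar>)\<^sup>2 \<le> (\<Sum>x\<in>res. (\<nu> x)\<^sup>2) * (\<Sum>x\<in>res. \<bar>h x\<bar>\<^sup>2)"
    by (rule Cauchy_Schwarz_ineq_sum)
  also have "\<dots> \<le> (M / real N) * (V * real N)"
  proof (rule mult_mono)
    have "(\<Sum>x\<in>res. (\<nu> x)\<^sup>2) \<le> (\<Sum>x\<in>res. M / real N * \<nu> x)"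
      unfolding power2_eq_square using \<nu> by (intro sum_mono mult_right_mono) auto
    also have "\<dots> = M / real N * (\<Sum>x\<in>res. \<nu> x)" by (simp add: sum_distrib_left)
    also have "\<dots> \<le> M / real N * 1" using \<nu> M by (intro mult_left_mono) auto
    finally show "(\<Sum>x\<in>res. (\<nu> x)\<^sup>2) \<le> M / real N" by simp
  qed (use V M in \<open>auto intro: sum_nonneg\<close>)
  also have "\<dots> = M * V" using N_pos by simp
  finally show "(\<Sum>x\<in>res. \<nu> x * \<bar>h x\<bar>) \<le> sqrt (M * V)" by (rule real_le_rsqrt)
qed

lemma small_smooth:
  assumes h: "periodic h" "small M h \<delta>" and S: "finite S" "S \<noteq> {}"
  shows "small M (smooth S h) \<delta>"
proof -
  have "small M (\<lambda>x. (\<Sum>s\<in>S. (\<Sum>s'\<in>S. h (x + (s - s'))) / real (card S)) / real (card S)) \<delta>"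
    by (intro small_average S small_shift h)
  moreover have "(\<Sum>s\<in>S. (\<Sum>s'\<in>S. h (x + (s - s'))) / real (card S)) / real (card S) = smooth S h x" for x
    by (simp add: smooth_def sum_divide_distrib power2_eq_square)
  ultimately show ?thesis by simp
qed

lemma smooth_diff: "smooth S (\<lambda>x. g x - h x) x = smooth S g x - smooth S h x"
  by (simp add: smooth_def sum_subtractf diff_divide_distrib)

text \<open>Smoothing averages translates and so does not increase the dual norm; telescoping
  charges one \<delta> per smoothing.\<close>

lemma small_smooth_iter_diff:
  assumes h: "periodic h" "small M (\<lambda>x. smooth S h x - h x) \<delta>" and S: "finite S" "S \<noteq> {}"
  shows "small M (\<lambda>x. (smooth S ^^ l) h x - h x) (real l * \<delta>)"
proof (induction l)
  case 0
  then show ?case by (simp add: small_zero)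
next
  case (Suc l)
  have "periodic (\<lambda>x. (smooth S ^^ l) h x - h x)"
    using periodic_smooth_iter[OF h(1)] h(1) by (simp add: periodic_def)
  from small_smooth[OF this Suc S]
  have "small M (\<lambda>x. (smooth S ^^ Suc l) h x - smooth S h x) (real l * \<delta>)"
    by (simp add: smooth_diff[abs_def])
  then have "small M (\<lambda>x. (smooth S ^^ Suc l) h x - h x) (real l * \<delta> + \<delta>)"
    by (rule small_triangle[OF _ h(2)]) simp
  then show ?case by (simp add: ring_distribs add.commute)
qed

text \<open>The function \<open>g\<close> mediates: for \<open>s\<close> and \<open>s'\<close> in
  \<open>S\<close>, g(x + s) is close to h(x) by the bound for \<open>s\<close>, and to h(x + s -
  s') by the bound for \<open>s'\<close> translated by s - s'.\<close>

lemma small_smooth_diff: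
  assumes per: "periodic h" "periodic g" and S: "finite S" "S \<noteq> {}"
    and small: "\<And>s. s \<in> S \<Longrightarrow> small M (\<lambda>x. g (x + s) - h x) \<delta>"
  shows "small M (\<lambda>x. smooth S h x - h x) (2 * \<delta>)"
proof -
  have *: "small M (\<lambda>x. h (x + (s - s')) - h x) (2 * \<delta>)" if "s \<in> S" "s' \<in> S" for s s'
  proof -
    have "periodic (\<lambda>x. g (x + s') - h x)"
      using periodic_shift[OF per(2), of s'] per(1) by (simp add: periodic_def)
    from small_shift[OF this small[OF that(2)], of "s - s'"]
    have "small M (\<lambda>x. g (x + s) - h (x + (s - s'))) \<delta>" by (simp add: algebra_simps)
    from small_triangle[OF this small[OF that(1)], of "\<lambda>x. h (x + (s - s')) - h x"]
    show ?thesis by simp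
  qed
  have "small M (\<lambda>x. (\<Sum>s\<in>S. (\<Sum>s'\<in>S. h (x + (s - s')) - h x) / real (card S)) / real (card S)) (2 * \<delta>)"
    by (intro small_average S *)
  moreover have "(\<Sum>s\<in>S. (\<Sum>s'\<in>S. h (x + (s - s')) - h x) / real (card S)) / real (card S)
      = smooth S h x - h x" for x
  proof -
    have "real (card S) > 0" using S by (simp add: card_gt_0_iff)
    then show ?thesis
      by (simp add: smooth_def sum_subtractf diff_divide_distrib sum_divide_distrib[symmetric] power2_eq_square)
  qed
  ultimately show ?thesis by simp
qed

text \<open>Go from h(x + t) to its smoothing, translate the smoothing by \<open>t\<close> at L2
  cost, and return to h(x). The two outer moves cost l \<delta> each.\<close>

lemma small_almost_period:
  assumes h: "periodic h" "\<And>x. \<bar>h x\<bar> \<le> W" and S: "S \<subseteq> res" "S \<noteq> {}" and M: "M \<ge> 0"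
    and smooth: "small M (\<lambda>x. smooth S h x - h x) \<delta>"
    and spec: "\<And>r. r \<in> spectrum S \<Longrightarrow> norm (ee r t - 1) \<le> \<eta>"
    and l: "2 * (1 / 4) ^ l \<le> \<eta>"
  shows "small M (\<lambda>x. h (x + t) - h x) (2 * (real l * \<delta>) + sqrt M * W * \<eta>)"
proof -
  let ?H = "(smooth S ^^ l) h"
  have fin: "finite S" using S finite_subset finite_res by blast
  have \<eta>: "\<eta> \<ge> 0" using l by (rule order_trans[rotated]) simp
  have W0: "W \<ge> 0" using h(2)[of 0] by linarith
  have 1: "small M (\<lambda>x. ?H x - h x) (real l * \<delta>)"
    by (rule small_smooth_iter_diff[OF h(1) smooth fin S(2)])
  have "periodic (\<lambda>x. ?H x - h x)"
    using periodic_smooth_iter[OF h(1)] h(1) by (simp add: periodic_def)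
  from small_shift[OF this 1, of t]
  have 2: "small M (\<lambda>x. ?H (x + t) - h (x + t)) (real l * \<delta>)" .
  have "(\<Sum>x\<in>res. (?H (x + t) - ?H x)\<^sup>2) \<le> \<eta>\<^sup>2 * (\<Sum>x\<in>res. (h x)\<^sup>2)"
    by (rule smooth_iter_almost_period[OF h(1) S spec l])
  also have "\<dots> \<le> \<eta>\<^sup>2 * (\<Sum>x\<in>res. W\<^sup>2)"
    using h(2) W0 by (intro mult_left_mono sum_mono) (auto simp: abs_le_square_iff[symmetric])
  also have "\<dots> = (\<eta> * W)\<^sup>2 * real N" by (simp add: power_mult_distrib)
  finally have "small M (\<lambda>x. ?H (x + t) - ?H x) (sqrt (M * (\<eta> * W)\<^sup>2))"
    by (rule small_of_sum_square[OF M])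
  then have 3: "small M (\<lambda>x. ?H (x + t) - ?H x) (sqrt M * W * \<eta>)"
    using \<eta> W0 by (simp add: real_sqrt_mult mult_ac)
  have "small M (\<lambda>x. h (x + t) - h x) ((real l * \<delta> + sqrt M * W * \<eta>) + real l * \<delta>)"
    by (rule small_triangle[OF small_triangle[OF 2 3, of "\<lambda>x. \<bar>?H (x + t) - h (x + t)\<bar> + \<bar>?H (x + t) - ?H x\<bar>"] 1]) auto
  then show ?thesis by (simp add: algebra_simps)
qed

section \<open>Popular sums\<close>

text \<open>Properness comes from also approximating 1/N. If i q and j q agree modulo
  \<open>N\<close>, then (j - i) q/N is an integer at distance less than 1 from (j - i) times the
  integer near q/N, hence equal to it; then \<open>N\<close> divides \<open>q\<close>, contradicting
  0 < q < N.\<close>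

lemma dirichlet_progression:
  assumes D: "finite D" and m: "m > 0" "m ^ (card D + 1) < N"
  obtains q :: nat where
    "\<And>d i. d \<in> D \<Longrightarrow> norm (ee d (int i * int q) - 1) \<le> real i * (2 * pi / real m)"
    "\<And>a. inj_on (\<lambda>i. (a + i * q) mod N) {..<m}"
proof -
  let ?n = "card D"
  obtain e where e: "bij_betw e {0..<?n} D" using ex_bij_betw_nat_finite[OF D] by blast
  \<comment> \<open>The index \<open>card D\<close> carries the extra frequency 1/N, whence the
    exponent \<open>card D + 1\<close>.\<close>
  define \<theta> where "\<theta> i = (if i < ?n then real_of_int (e i) / real N else 1 / real N)" for i
  obtain q' p where q': "0 < q'" "q' \<le> int (m ^ (?n + 1))"
    and p: "\<And>i. i < ?n + 1 \<Longrightarrow> \<bar>of_int q' * \<theta> i - of_int (p i)\<bar> < 1 / real m"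
    using Dirichlet_approx_simult[OF m(1), of "?n + 1" \<theta>] by blast
  define q where "q = nat q'"
  have q: "0 < q" "q < N" "q' = int q" using q' m(2) unfolding q_def by linarith+
  show ?thesis
  proof (rule that[of q])
    fix d i assume "d \<in> D"
    then obtain j where j: "j < ?n" "e j = d"
      by (metis atLeastLessThan_iff bij_betw_imp_surj_on e imageE)
    have "\<bar>of_int d * of_int (int q) / real N - of_int (p j)\<bar> \<le> 1 / real m"
      using p[of j] j q(3) by (simp add: \<theta>_def mult.commute)
    from norm_ee_minus_1_le[OF this] have "norm (ee d (int q) - 1) \<le> 2 * pi / real m" by simp
    then have "real i * norm (ee d (int q) - 1) \<le> real i * (2 * pi / real m)"
      by (intro mult_left_mono) auto
    then show "norm (ee d (int i * int q) - 1) \<le> real i * (2 * pi / real m)"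
      using norm_ee_minus_1_mult[of d i "int q"] by linarith
  next
    fix a
    have P: "\<bar>real q / real N - of_int (p ?n)\<bar> < 1 / real m"
      using p[of ?n] q(3) by (simp add: \<theta>_def)
    have no: False if ij: "i < j" "j < m" and eq: "(a + i * q) mod N = (a + j * q) mod N" for i j
    proof -
      have "(a + j * q) - (a + i * q) = (j - i) * q" using ij by (simp add: algebra_simps)
      then have "N dvd (j - i) * q"
        using eq ij by (metis mod_eq_dvd_iff_nat add_left_mono mult_le_mono1 less_imp_le)
      then obtain z where z: "(j - i) * q = N * z" by (auto simp: dvd_def)
      then have rz: "real (j - i) * real q = real N * real z" by (metis of_nat_mult)
      define P' where "P' = p ?n"
      have "\<bar>real z - real (j - i) * of_int P'\<bar> = real (j - i) * \<bar>real q / real N - of_int P'\<bar>"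
      proof -
        have "real z - real (j - i) * of_int P' = real (j - i) * (real q / real N - of_int P')"
          using rz N_pos by (simp add: field_simps)
        then show ?thesis by (simp add: abs_mult)
      qed
      also have "\<dots> < real (j - i) * (1 / real m)"
        using P ij unfolding P'_def by (intro mult_strict_left_mono) auto
      also have "\<dots> \<le> 1" using ij m by (simp add: field_simps)
      finally have "\<bar>real_of_int (int z - int (j - i) * P')\<bar> < 1" by simp
      then have "int z = int (j - i) * P'" by linarith
      then have "int ((j - i) * q) = int (j - i) * (int N * P')" using z by (simp add: mult_ac)
      then have "int q = int N * P'" using ij by simp
      then have "int N dvd int q" by simp
      then show False using q by (auto dest: dvd_imp_le)
    qed
    show "inj_on (\<lambda>i. (a + i * q) mod N) {..<m}"
    proof (rule inj_onI)
      fix i j assume ij: "i \<in> {..<m}" "j \<in> {..<m}" "(a + i * q) mod N = (a + j * q) mod N"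
      have "\<not> i < j" using no[of i j] ij by auto
      moreover have "\<not> j < i" using no[of j i] ij by auto
      ultimately show "i = j" by simp
    qed
  qed
qed

section \<open>The convolution 1_A * mu_B and its averages over x - C\<close>

definition mean_indicator :: "int set \<Rightarrow> int set \<Rightarrow> int \<Rightarrow> real" where
  "mean_indicator A B x = (\<Sum>b\<in>B. of_bool ((x - b) mod int N \<in> A)) / real (card B)"

lemma periodic_of_bool_mod: "periodic (\<lambda>x. of_bool (x mod int N \<in> A))"
  by (simp add: periodic_def)

lemma periodic_mean_indicator: "periodic (mean_indicator A B)"
  unfolding periodic_def mean_indicator_def by (simp add: mod_simps)

lemma sum_of_bool_mod: "A \<subseteq> res \<Longrightarrow> (\<Sum>x\<in>res. g x * of_bool (x mod int N \<in> A)) = (\<Sum>x\<in>A. g x :: real)"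
proof -
  assume A: "A \<subseteq> res"
  have "(\<Sum>x\<in>res. g x * of_bool (x mod int N \<in> A)) = (\<Sum>x\<in>res. if x \<in> A then g x else 0)"
    by (intro sum.cong refl) (simp add: mod_res_id)
  also have "\<dots> = (\<Sum>x\<in>res \<inter> A. g x)" by (simp add: sum.inter_restrict)
  finally show ?thesis using A by (simp add: Int_absorb1)
qed

lemma sum_mean_indicator:
  assumes A: "A \<subseteq> res" and B: "finite B" "B \<noteq> {}"
  shows "(\<Sum>x\<in>res. mean_indicator A B x) = real (card A)"
proof -
  have one: "(\<Sum>x\<in>res. of_bool ((x - b) mod int N \<in> A)) = real (card A)" for b
  proof -
    have "(\<Sum>x\<in>res. of_bool ((x + - b) mod int N \<in> A) :: real) = (\<Sum>x\<in>res. 1 * of_bool (x mod int N \<in> A))"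
      unfolding mult_1 by (rule sum_periodic_shift[OF periodic_of_bool_mod])
    also have "\<dots> = (\<Sum>x\<in>A. 1)" by (rule sum_of_bool_mod[OF A])
    finally show ?thesis by (simp only: diff_conv_add_uminus) simp
  qed
  have "(\<Sum>x\<in>res. mean_indicator A B x) = (\<Sum>b\<in>B. \<Sum>x\<in>res. of_bool ((x - b) mod int N \<in> A)) / real (card B)"
    unfolding mean_indicator_def sum_divide_distrib[symmetric] by (subst sum.swap) simp
  then show ?thesis using B unfolding one by (simp add: card_gt_0_iff)
qed

lemma mean_indicator_bounds: "0 \<le> mean_indicator A B x \<and> mean_indicator A B x \<le> 1"
proof -
  have "(\<Sum>b\<in>B. of_bool ((x - b) mod int N \<in> A)) \<le> (\<Sum>b\<in>B. 1 :: real)"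
    by (intro sum_mono) auto
  then show ?thesis
    unfolding mean_indicator_def by (auto intro!: divide_nonneg_nonneg sum_nonneg divide_le_eq_1[THEN iffD2])
qed

text \<open>The mean of the left side over all \<open>x\<close> is the right side.\<close>

lemma exists_large_average:
  assumes A: "A \<subseteq> res" and B: "finite B" "B \<noteq> {}" and C: "finite C"
  obtains x where "(\<Sum>c\<in>C. mean_indicator A B (x - c)) \<ge> real (card A) / real N * real (card C)"
proof -
  have "(\<Sum>x\<in>res. \<Sum>c\<in>C. mean_indicator A B (x - c)) = (\<Sum>c\<in>C. \<Sum>x\<in>res. mean_indicator A B (x + - c))"
    by (subst sum.swap) simp
  also have "\<dots> = real (card C) * real (card A)"
    unfolding sum_periodic_shift[OF periodic_mean_indicator] sum_mean_indicator[OF A B] by simp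
  finally have s: "(\<Sum>x\<in>res. \<Sum>c\<in>C. mean_indicator A B (x - c)) = real (card C) * real (card A)" .
  have "\<exists>x\<in>res. (\<Sum>c\<in>C. mean_indicator A B (x - c)) \<ge> real (card A) / real N * real (card C)"
  proof (rule ccontr)
    assume "\<not> ?thesis"
    then have "(\<Sum>x\<in>res. \<Sum>c\<in>C. mean_indicator A B (x - c)) < (\<Sum>x\<in>res. real (card A) / real N * real (card C))"
      using N_pos by (intro sum_strict_mono) (auto simp: res_def not_le)
    then show False using N_pos s by simp
  qed
  then show ?thesis using that by blast
qed

text \<open>Convexity of exp keeps the loss first order in the logarithmic difference, averaged against
  the density proportional to \<open>f\<close> on \<open>x - C\<close>, which is at most \<open>1 / (\<alpha> \<gamma>)\<close>.\<close>

lemma average_shift_ge: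
  assumes C: "C \<subseteq> res" "C \<noteq> {}" and f: "periodic f" "\<And>x. 0 \<le> f x \<and> f x \<le> 1" and a: "a > 0"
    and F: "F = (\<Sum>c\<in>C. f (x - c))" "F > 0" "real N \<le> M * F"
    and small: "small M (\<lambda>y. ln (1 + f (y + t) / a) - ln (1 + f y / a)) \<delta>"
  shows "(\<Sum>c\<in>C. f (x + t - c)) \<ge> (1 - \<delta>) * F - a * real (card C)"
proof -
  define \<Delta> where "\<Delta> y = ln (1 + f (y + t) / a) - ln (1 + f y / a)" for y
  define \<nu> where "\<nu> y = f y * of_bool ((x - y) mod int N \<in> C) / F" for y
  have per\<nu>: "periodic \<nu>" using f(1) by (auto simp: periodic_def \<nu>_def mod_simps)
  have sum\<nu>: "(\<Sum>y\<in>res. \<nu> y * g y) = (\<Sum>c\<in>C. f (x - c) * g (x - c)) / F" if g: "periodic g" for g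
  proof -
    have "periodic (\<lambda>y. \<nu> y * g y)" using per\<nu> g by (simp add: periodic_def)
    from sum_periodic_reflect[OF this, of x]
    have "(\<Sum>y\<in>res. \<nu> y * g y) = (\<Sum>y\<in>res. \<nu> (x - y) * g (x - y))" ..
    also have "\<dots> = (\<Sum>y\<in>res. f (x - y) * g (x - y) / F * of_bool (y mod int N \<in> C))"
      by (simp add: \<nu>_def mult_ac)
    finally show ?thesis unfolding sum_of_bool_mod[OF C(1)] by (simp add: sum_divide_distrib)
  qed
  have "(\<Sum>y\<in>res. \<nu> y) \<le> 1"
    using sum\<nu>[of "\<lambda>_. 1"] F by (simp add: periodic_def)
  moreover have "0 \<le> \<nu> y \<and> \<nu> y \<le> M / real N" for y
  proof -
    have "\<nu> y \<le> 1 / F" using f(2)[of y] F(2) by (auto simp: \<nu>_def intro: divide_right_mono)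
    also have "\<dots> \<le> M / real N" using F N_pos by (simp add: field_simps)
    finally show ?thesis using f(2) F(2) by (auto simp: \<nu>_def)
  qed
  ultimately have "(\<Sum>y\<in>res. \<nu> y * \<bar>\<Delta> y\<bar>) \<le> \<delta>"
    using small per\<nu> unfolding small_def \<Delta>_def by blast
  moreover have "periodic (\<lambda>y. \<bar>\<Delta> y\<bar>)"
    using f(1) periodic_shift[OF f(1), of t] by (simp add: periodic_def \<Delta>_def)
  ultimately have "(\<Sum>c\<in>C. f (x - c) * \<bar>\<Delta> (x - c)\<bar>) \<le> \<delta> * F"
    using sum\<nu>[of "\<lambda>y. \<bar>\<Delta> y\<bar>"] F(2) by (simp add: field_simps)
  moreover have "f (x - c) * (1 - \<bar>\<Delta> (x - c)\<bar>) - a \<le> f (x + t - c)" for c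
  proof -
    define y where "y = x - c"
    have pos: "1 + f z / a > 0" for z using f(2)[of z] a by (simp add: add_pos_nonneg)
    have "exp (\<Delta> y) = (1 + f (y + t) / a) / (1 + f y / a)"
      unfolding \<Delta>_def using pos by (simp add: exp_diff)
    then have *: "(f y + a) * exp (\<Delta> y) = f (y + t) + a"
      using a f(2)[of y] pos[of y] by (simp add: divide_simps add.commute) (simp add: algebra_simps)
    \<comment> \<open>Enlarging \<open>f y\<close> to \<open>f y + a\<close> makes the product
      exactly f(y + t) + a; the surplus \<open>a\<close> for each element of \<open>C\<close> is the
      subtracted term \<open>a * card C\<close>.\<close>
    have "1 - \<bar>\<Delta> y\<bar> \<le> exp (\<Delta> y)" using exp_ge_add_one_self[of "\<Delta> y"] by linarith
    then have "f y * (1 - \<bar>\<Delta> y\<bar>) \<le> f y * exp (\<Delta> y)"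
      using f(2)[of y] by (intro mult_left_mono) auto
    also have "\<dots> \<le> (f y + a) * exp (\<Delta> y)" using a by (intro mult_right_mono) auto
    finally show ?thesis unfolding * by (simp add: y_def algebra_simps)
  qed
  then have "(\<Sum>c\<in>C. f (x - c) * (1 - \<bar>\<Delta> (x - c)\<bar>) - a) \<le> (\<Sum>c\<in>C. f (x + t - c))"
    by (rule sum_mono)
  ultimately show ?thesis
    by (simp add: right_diff_distrib sum_subtractf F(1)[symmetric] left_diff_distrib mult.commute)
qed

text \<open>\<open>D\<close> generates the large spectrum of the sampled shift set, so every
  \<open>t\<close> in its Bohr set is an almost period of the logarithm. The base point
  \<open>x\<close> is one where the average of 1_A * mu_B over x - C is at least \<alpha>.\<close>

lemma bohr_set_of_popular_sums:
  fixes k l :: nat and \<alpha> \<beta> \<gamma> :: real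
  assumes A: "A \<subseteq> res" "A \<noteq> {}" and B: "B \<subseteq> res" "B \<noteq> {}" and C: "C \<subseteq> res" "C \<noteq> {}"
    and \<alpha>: "\<alpha> = real (card A) / real N" and \<beta>: "\<beta> = real (card B) / real N" and \<gamma>: "\<gamma> = real (card C) / real N"
    and M: "M = 1 / (\<alpha> * \<gamma>)" and W: "W = ln (1 + 4 / \<alpha>)" and l: "l > 0" "2 * (1 / 4) ^ l \<le> \<eta>"
    and k: "k > 0" "256 * real l * W * M * exp (- (real k * \<alpha> / (16 * (128 * real l)\<^sup>2))) \<le> 1"
    and \<eta>: "8 * sqrt M * W * \<eta> \<le> 1"
  obtains x D where "D \<subseteq> res" "real (card D) \<le> 16 * (ln 2 + real k * ln (1 / \<beta>))"
    "\<And>t. (\<Sum>d\<in>D. norm (ee d t - 1)) \<le> \<eta>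
      \<Longrightarrow> (\<Sum>c\<in>C. \<Sum>b\<in>B. of_bool ((x + t - c - b) mod int N \<in> A))
        \<ge> \<alpha> / 2 * real (card B) * real (card C)"
proof -
  have fin: "finite A" "finite B" "finite C" using A B C finite_subset finite_res by blast+
  have pos: "\<alpha> > 0" "\<beta> > 0" "\<gamma> > 0" 
    using fin A B C N_pos by (simp_all add: \<alpha> \<beta> \<gamma> card_gt_0_iff)
  have M0: "M > 0" using pos by (simp add: M)
  \<comment> \<open>With \<open>a\<close> a quarter of \<alpha>, the final count is 3/4 - 1/4 = 1/2
    of \<alpha>. The choice of \<delta> makes the sampling part 8 l \<delta> of the loss equal to
    1/16.\<close>
  define a where "a = \<alpha> / 4"
  define \<delta> where "\<delta> = 1 / (128 * real l)"
  define \<kappa> where "\<kappa> = exp (- (real k * \<delta>\<^sup>2 * a / 4))"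
  have a: "a > 0" using pos by (simp add: a_def)
  have \<delta>: "0 < \<delta>" "\<delta> \<le> 1 / 2" using l(1) by (auto simp: \<delta>_def field_simps)
  have Wa: "W = ln (1 + 1 / a)" by (simp add: W a_def)
  let ?f = "mean_indicator A B" and ?\<phi> = "\<lambda>x. of_bool (x mod int N \<in> A) :: real"
  define h where "h x = ln (1 + ?f x / a)" for x
  obtain S g where S: "S \<subseteq> res" "real (card S) \<ge> (real (card B) / real N) ^ k * real N / 2"
    and g: "periodic g" "\<And>x. 0 \<le> g x \<and> g x \<le> W"
    and near: "\<And>s. s \<in> S \<Longrightarrow> real (card {x \<in> res. \<bar>g (x + s) - h x\<bar> > 2 * \<delta>}) \<le> 4 * \<kappa> * real N"
    unfolding h_def Wa \<kappa>_def
    by (rule sampling_translates[of ?\<phi> B ?f \<delta> a k])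
      (use B \<delta> a k(1) in \<open>auto simp: mean_indicator_def periodic_of_bool_mod\<close>)
  have cS: "real (card S) > 0"
  proof -
    have "(real (card B) / real N) ^ k * real N / 2 > 0" using pos(2) N_pos by (simp add: \<alpha> \<beta> \<gamma>)
    then show ?thesis using S(2) by linarith
  qed
  then have S0: "finite S" "S \<noteq> {}" using card_gt_0_iff[of S] by auto
  have h: "periodic h" "0 \<le> h x \<and> h x \<le> W" for x
  proof -
    show "periodic h" using periodic_mean_indicator[of A B] by (simp add: periodic_def h_def)
    show "0 \<le> h x \<and> h x \<le> W"
      using mean_indicator_bounds[of A B x] a unfolding h_def Wa
      by (auto intro!: divide_right_mono add_pos_nonneg ln_ge_zero ln_mono)
  qed
  have "small M (\<lambda>x. g (x + s) - h x) (2 * \<delta> + W * M * (4 * \<kappa>))" if "s \<in> S" for s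
  proof (rule small_except)
    show "\<bar>g (x + s) - h x\<bar> \<le> W" for x using g(2)[of "x + s"] h(2)[of x] by linarith
  qed (use near[OF that] \<delta> M0 in auto)
  from small_smooth_diff[OF h(1) g(1) S0 this]
  have sm: "small M (\<lambda>x. smooth S h x - h x) (2 * (2 * \<delta> + W * M * (4 * \<kappa>)))" .
  define loss where "loss = 2 * (real l * (2 * (2 * \<delta> + W * M * (4 * \<kappa>)))) + sqrt M * W * \<eta>"
  \<comment> \<open>Budget: 1/16 from the sampling accuracy, 1/16 from the exceptional points, 1/8
    from the translation of the smoothed function.\<close>
  have total: "loss \<le> 1 / 4"
  proof -
    have "real k * \<delta>\<^sup>2 * a / 4 = real k * \<alpha> / (16 * (128 * real l)\<^sup>2)"
      by (simp add: \<delta>_def a_def power_divide)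
    then have "\<kappa> = exp (- (real k * \<alpha> / (16 * (128 * real l)\<^sup>2)))" by (simp only: \<kappa>_def)
    then have "256 * real l * W * M * \<kappa> \<le> 1" using k(2) by (simp only:)
    moreover have "real l * \<delta> = 1 / 128" using l(1) by (simp add: \<delta>_def)
    moreover have "2 * (real l * (2 * (2 * \<delta> + W * M * (4 * \<kappa>)))) = 8 * (real l * \<delta>) + (256 * real l * W * M * \<kappa>) / 16"
      by (simp add: algebra_simps)
    ultimately show ?thesis using \<eta> unfolding loss_def by linarith
  qed
  obtain x where x: "(\<Sum>c\<in>C. ?f (x - c)) \<ge> \<alpha> * real (card C)"
    using exists_large_average[OF A(1) fin(2) B(2) fin(3)] unfolding \<alpha> by blast
  define F where "F = (\<Sum>c\<in>C. ?f (x - c))"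
  have cC: "real (card C) > 0" using fin C by (simp add: card_gt_0_iff)
  have F: "F > 0" "real N \<le> M * F"
  proof -
    show "F > 0" using x pos cC unfolding F_def by (smt (verit) mult_pos_pos)
    have "\<alpha> * real (card C) = \<alpha> * \<gamma> * real N" using N_pos by (simp add: \<alpha> \<beta> \<gamma>)
    then have "real N = M * (\<alpha> * real (card C))" using pos by (simp add: M)
    also have "\<dots> \<le> M * F" using x M0 unfolding F_def by (intro mult_left_mono) auto
    finally show "real N \<le> M * F" .
  qed
  obtain D where D: "D \<subseteq> res" "real (card D) \<le> 16 * ln (real N / real (card S))"
    "\<And>r x. r \<in> spectrum S \<Longrightarrow> norm (ee r x - 1) \<le> (\<Sum>d\<in>D. norm (ee d x - 1))"
    using spectrum_cover[OF S(1) S0(2)] by blast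
  show ?thesis
  proof (rule that[of D x])
    show "D \<subseteq> res" by (rule D(1))
    have "real N / real (card S) \<le> real N / ((real (card B) / real N) ^ k * real N / 2)"
      using S(2) pos(2) N_pos cS by (intro divide_left_mono) (auto simp: \<alpha> \<beta> \<gamma>)
    also have "\<dots> = 2 * (1 / \<beta>) ^ k" using N_pos by (simp add: \<alpha> \<beta> \<gamma> power_divide)
    finally have "ln (real N / real (card S)) \<le> ln (2 * (1 / \<beta>) ^ k)"
      using cS N_pos by (intro ln_mono) auto
    also have "\<dots> = ln 2 + real k * ln (1 / \<beta>)"
      using pos by (simp add: ln_mult_pos ln_realpow)
    finally show "real (card D) \<le> 16 * (ln 2 + real k * ln (1 / \<beta>))" using D(2) by simp
    fix t assume t: "(\<Sum>d\<in>D. norm (ee d t - 1)) \<le> \<eta>"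
    have hW: "\<bar>h y\<bar> \<le> W" for y using h(2)[of y] by simp
    have spec: "norm (ee r t - 1) \<le> \<eta>" if "r \<in> spectrum S" for r
      using D(3)[OF that, of t] t by linarith
    have "small M (\<lambda>y. h (y + t) - h y) loss"
      unfolding loss_def
      by (rule small_almost_period[OF h(1) hW S(1) S0(2) less_imp_le[OF M0] sm spec l(2)])
    then have "small M (\<lambda>y. ln (1 + ?f (y + t) / a) - ln (1 + ?f y / a)) loss"
      by (simp add: h_def)
    from average_shift_ge[OF C periodic_mean_indicator mean_indicator_bounds a F_def F this]
    have "(\<Sum>c\<in>C. ?f (x + t - c)) \<ge> (1 - loss) * F - a * real (card C)" .
    moreover have "(1 - loss) * F \<ge> (3 / 4) * F"
      using total F by (intro mult_right_mono) auto
    moreover have "(3 / 4) * F \<ge> (3 / 4) * (\<alpha> * real (card C))" using x by (simp add: F_def)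
    moreover have "(3 / 4) * (\<alpha> * real (card C)) - a * real (card C) = \<alpha> / 2 * real (card C)"
      by (simp add: a_def)
    ultimately have "(\<Sum>c\<in>C. ?f (x + t - c)) \<ge> \<alpha> / 2 * real (card C)" by linarith
    moreover have "(\<Sum>c\<in>C. ?f (x + t - c)) = (\<Sum>c\<in>C. \<Sum>b\<in>B. of_bool ((x + t - c - b) mod int N \<in> A)) / real (card B)"
      by (simp add: mean_indicator_def sum_divide_distrib)
    moreover have "real (card B) > 0" using fin B by (simp add: card_gt_0_iff)
    ultimately show "(\<Sum>c\<in>C. \<Sum>b\<in>B. of_bool ((x + t - c - b) mod int N \<in> A))
        \<ge> \<alpha> / 2 * real (card B) * real (card C)"
      by (simp add: pos_le_divide_eq mult_ac)
  qed
qed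

end

section \<open>Choice of parameters\<close>

text \<open>Lets powers of exp \<Lambda> absorb numerical constants.\<close>

lemma exp_multiple_ge_power_two:
  fixes \<Lambda> :: real
  assumes "ln 2 \<le> \<Lambda>"
  shows "2 ^ n \<le> exp (real n * \<Lambda>)"
proof -
  have "(2 :: real) ^ n = exp (real n * ln 2)" by (simp add: exp_of_nat_mult)
  also have "\<dots> \<le> exp (real n * \<Lambda>)" using assms by (simp add: mult_left_mono)
  finally show ?thesis .
qed

text \<open>Everything is compared with powers of exp \<Lambda>: \<open>M\<close>, \<open>W\<close>
  and \<open>l\<close> are each at most a constant times exp \<Lambda>, and \<eta> is exactly what
  cancels the bounds for sqrt M and \<open>W\<close>.\<close>

lemma parameter_choice:
  fixes \<alpha> M \<Lambda> :: real
  assumes \<alpha>: "0 < \<alpha>" "\<alpha> \<le> 1" "1 / \<alpha> \<le> exp \<Lambda> / 2" and M: "1 \<le> M" "M \<le> exp \<Lambda> / 2" and \<Lambda>: "ln 2 \<le> \<Lambda>"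
  defines "W \<equiv> ln (1 + 4 / \<alpha>)" and "\<eta> \<equiv> exp (- 2 * \<Lambda>) / 8"
  obtains k l :: nat where "l > 0" "2 * (1 / 4) ^ l \<le> \<eta>" "k > 0"
    "256 * real l * W * M * exp (- (real k * \<alpha> / (16 * (128 * real l)\<^sup>2))) \<le> 1"
    "8 * sqrt M * W * \<eta> \<le> 1" "real k + 1 \<le> 4 * 10 ^ 8 * \<Lambda> ^ 3 / \<alpha>"
proof -
  \<comment> \<open>The constant in \<open>k\<close> is 15 * 16 * 128^2 * 10^2, where 10 comes from
    l <= 10 \<Lambda> and 15 from the exponent wanted below.\<close>
  define l k where "l = nat \<lceil>8 * \<Lambda>\<rceil>" and "k = nat \<lceil>393216000 * \<Lambda> ^ 3 / \<alpha>\<rceil>"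
  have \<Lambda>2: "\<Lambda> \<ge> 1 / 2" using \<Lambda> ln2_ge_two_thirds by simp
  have l: "8 * \<Lambda> \<le> real l" "real l \<le> 10 * \<Lambda>" using \<Lambda>2 unfolding l_def by linarith+
  have \<Lambda>3: "1 \<le> 8 * \<Lambda> ^ 3" using power_mono[OF \<Lambda>2, of 3] by (simp add: power_divide)
  have "1 \<le> 8 * \<Lambda> ^ 3 / \<alpha>" using \<Lambda>3 \<alpha> by (simp add: pos_le_divide_eq)
  then have k: "393216000 * \<Lambda> ^ 3 / \<alpha> \<le> real k" "real k + 1 \<le> 4 * 10 ^ 8 * \<Lambda> ^ 3 / \<alpha>" "k > 0"
  proof -
    define X where "X = \<Lambda> ^ 3 / \<alpha>"
    assume "1 \<le> 8 * \<Lambda> ^ 3 / \<alpha>"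
    then have X: "1 \<le> 8 * X" by (simp add: X_def)
    have kX: "k = nat \<lceil>393216000 * X\<rceil>" by (simp add: k_def X_def)
    have c: "real k < 393216000 * X + 1" "393216000 * X \<le> real k"
      using X unfolding kX by linarith+
    then have "real k > 0" "real k + 1 \<le> 400000000 * X" using X by linarith+
    with c(2) show "393216000 * \<Lambda> ^ 3 / \<alpha> \<le> real k" "real k + 1 \<le> 4 * 10 ^ 8 * \<Lambda> ^ 3 / \<alpha>" "k > 0"
      by (simp_all add: X_def)
  qed
  have W: "0 \<le> W" "W \<le> 2 * exp \<Lambda>"
  proof -
    show "0 \<le> W" using \<alpha> by (simp add: W_def)
    have "W \<le> 4 / \<alpha>" unfolding W_def using \<alpha> by (intro ln_add_one_self_le_self) auto
    then show "W \<le> 2 * exp \<Lambda>" using \<alpha>(3) by simp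
  qed
  show ?thesis
  proof (rule that[of l k])
    show l0: "l > 0" using l \<Lambda>2 by linarith
    have "(1 / 4 :: real) ^ l = 1 / 4 ^ l" by (simp add: power_divide)
    also have "\<dots> \<le> 1 / exp (8 * \<Lambda>)"
    proof -
      have "exp (8 * \<Lambda>) \<le> exp (real l * 1)" using l by simp
      also have "\<dots> = exp 1 ^ l" by (rule exp_of_nat_mult)
      also have "\<dots> \<le> 4 ^ l" using exp_le by (intro power_mono) auto
      finally show ?thesis by (intro divide_left_mono) auto
    qed
    also have "\<dots> = exp (- 2 * \<Lambda>) * (1 / exp (6 * \<Lambda>))"
      by (simp add: exp_minus[symmetric] exp_add[symmetric] inverse_eq_divide[symmetric])
    also have "\<dots> \<le> exp (- 2 * \<Lambda>) * (1 / 64)"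
      using exp_multiple_ge_power_two[OF \<Lambda>, of 6] by (intro mult_left_mono divide_left_mono) auto
    finally have "(1 / 4) ^ l \<le> exp (- 2 * \<Lambda>) * (1 / 64)" .
    moreover have "0 < exp (- 2 * \<Lambda>)" by simp
    ultimately show "2 * (1 / 4) ^ l \<le> \<eta>" unfolding \<eta>_def by linarith
    show "k > 0" "real k + 1 \<le> 4 * 10 ^ 8 * \<Lambda> ^ 3 / \<alpha>" by fact+
    \<comment> \<open>Of the 15, three cancel the growth of \<open>l\<close>, \<open>W\<close> and
      \<open>M\<close>; the other twelve give 2^12 = 4096, which exceeds the remaining constant
      2560.\<close>
    have e15: "15 * \<Lambda> \<le> real k * \<alpha> / (16 * (128 * real l)\<^sup>2)"
    proof -
      have "15 * \<Lambda> * (16 * (128 * real l)\<^sup>2) \<le> 15 * \<Lambda> * (16 * (128 * (10 * \<Lambda>))\<^sup>2)"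
        using l \<Lambda>2 by (intro mult_left_mono power_mono) auto
      also have "\<dots> = 393216000 * \<Lambda> ^ 3" by (simp add: power2_eq_square power3_eq_cube)
      also have "\<dots> \<le> real k * \<alpha>" using k(1) \<alpha> by (simp add: pos_divide_le_eq)
      finally show ?thesis using l0 by (simp add: pos_le_divide_eq)
    qed
    have "256 * real l * W * M * exp (- (real k * \<alpha> / (16 * (128 * real l)\<^sup>2)))
        \<le> 256 * (10 * exp \<Lambda>) * (2 * exp \<Lambda>) * (exp \<Lambda> / 2) * exp (- (15 * \<Lambda>))"
    proof (intro mult_mono)
      show "real l \<le> 10 * exp \<Lambda>" using l(2) exp_ge_add_one_self[of \<Lambda>] by linarith
    qed (use W M e15 in auto)
    also have "\<dots> = 2560 * (exp \<Lambda> * exp \<Lambda> * exp \<Lambda> * exp (- (15 * \<Lambda>)))" by simp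
    also have "exp \<Lambda> * exp \<Lambda> * exp \<Lambda> * exp (- (15 * \<Lambda>)) = 1 / exp (12 * \<Lambda>)"
      by (simp add: exp_add[symmetric] exp_minus[symmetric] inverse_eq_divide[symmetric])
    also have "2560 * (1 / exp (12 * \<Lambda>)) \<le> 2560 * (1 / 2 ^ 12)"
      using exp_multiple_ge_power_two[OF \<Lambda>, of 12] by (intro mult_left_mono divide_left_mono) auto
    also have "\<dots> \<le> 1" by simp
    finally show "256 * real l * W * M * exp (- (real k * \<alpha> / (16 * (128 * real l)\<^sup>2))) \<le> 1" .
    have "sqrt M \<le> M" using M real_sqrt_le_iff[of M "M\<^sup>2"] self_le_power[of M 2] by simp
    then have "8 * sqrt M * W * \<eta> \<le> 8 * (exp \<Lambda> / 2) * (2 * exp \<Lambda>) * \<eta>"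
      using M W by (intro mult_mono) (auto simp: \<eta>_def)
    also have "\<dots> = 1" by (simp add: \<eta>_def exp_add[symmetric])
    finally show "8 * sqrt M * W * \<eta> \<le> 1" .
  qed
qed

text \<open>\<open>X\<close> is the intended length. The exponent 1/(4 n) lets Dirichlet's theorem
  run with m about X^2, since then m^n is about the square root of \<open>N\<close>. As
  \<open>n\<close> is of order \<Lambda>^4/\<alpha>, the length bound with \<Lambda>^5 follows from
  \<Lambda> >= 1/2.\<close>

lemma progression_scale:
  fixes \<alpha> \<Lambda> :: real and N n :: nat
  assumes \<alpha>: "0 < \<alpha>" "\<alpha> \<le> 1" "1 / \<alpha> \<le> exp \<Lambda> / 2" and \<Lambda>: "ln 2 \<le> \<Lambda>" and N: "N > 0"
    and n: "n > 0" "real n \<le> 7 * 10 ^ 9 * \<Lambda> ^ 4 / \<alpha>"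
    and large: "10 ^ 13 * \<Lambda> ^ 7 \<le> \<alpha> * ln (real N)"
  obtains X :: real where "X = real N powr (1 / (4 * real n))" "X ^ (4 * n) = real N"
    "X \<ge> 128 * real n * exp (2 * \<Lambda>)" "X \<ge> real N powr (1 / 10 ^ 13 * \<alpha> / \<Lambda> ^ 5)"
proof -
  define X where "X = real N powr (1 / (4 * real n))"
  have \<Lambda>2: "\<Lambda> \<ge> 1 / 2" using \<Lambda> ln2_ge_two_thirds by simp
  have lnN: "0 \<le> ln (real N)" using N by simp
  have scale: "\<alpha> / (28 * 10 ^ 9 * \<Lambda> ^ 4) \<le> 1 / (4 * real n)"
    using n \<alpha> \<Lambda>2 by (simp add: field_simps)
  have lnX: "ln X = ln (real N) / (4 * real n)" using N by (simp add: X_def ln_powr)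
  \<comment> \<open>51 = 47 + 4: the target is a constant below 2^47 times exp(4 \<Lambda>).\<close>
  have "51 * \<Lambda> \<le> 10 ^ 13 * \<Lambda> ^ 3 / (28 * 10 ^ 9)"
  proof -
    have "(1 / 2)\<^sup>2 * \<Lambda> \<le> \<Lambda>\<^sup>2 * \<Lambda>" using \<Lambda>2 by (intro mult_right_mono power_mono) auto
    then have "\<Lambda> \<le> 4 * \<Lambda> ^ 3" by (simp add: power2_eq_square power3_eq_cube)
    then show ?thesis using \<Lambda>2 by simp
  qed
  also have "\<dots> = 10 ^ 13 * \<Lambda> ^ 7 / (28 * 10 ^ 9 * \<Lambda> ^ 4)"
    using \<Lambda>2 by (simp add: power_eq_if[of \<Lambda> 7] field_simps eval_nat_numeral)
  also have "\<dots> \<le> \<alpha> * ln (real N) / (28 * 10 ^ 9 * \<Lambda> ^ 4)"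
    using large \<Lambda>2 by (intro divide_right_mono) auto
  also have "\<dots> = \<alpha> / (28 * 10 ^ 9 * \<Lambda> ^ 4) * ln (real N)" by simp
  also have "\<dots> \<le> 1 / (4 * real n) * ln (real N)" by (rule mult_right_mono[OF scale lnN])
  finally have "51 * \<Lambda> \<le> ln X" by (simp add: lnX)
  then have "exp (51 * \<Lambda>) \<le> X"
    using N by (metis X_def exp_le_cancel_iff exp_ln of_nat_0_less_iff powr_gt_zero order_less_irrefl)
  moreover have "128 * real n * exp (2 * \<Lambda>) \<le> exp (51 * \<Lambda>)"
  proof -
    have "\<Lambda> ^ 4 \<le> 256 * exp \<Lambda>"
    proof -
      have "(\<Lambda> / 4) ^ 4 \<le> (1 + \<Lambda> / of_nat 4) ^ 4" using \<Lambda>2 by (intro power_mono) auto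
      also have "\<dots> \<le> exp \<Lambda>" using \<Lambda>2 by (intro exp_ge_one_plus_x_over_n_power_n) auto
      finally show ?thesis by (simp add: power_divide)
    qed
    have "real n \<le> 7 * 10 ^ 9 * (\<Lambda> ^ 4 * (1 / \<alpha>))" using n by simp
    also have "\<dots> \<le> 7 * 10 ^ 9 * ((256 * exp \<Lambda>) * (exp \<Lambda> / 2))"
      using \<open>\<Lambda> ^ 4 \<le> 256 * exp \<Lambda>\<close> \<alpha> by (intro mult_left_mono mult_mono) auto
    finally have "128 * real n * exp (2 * \<Lambda>) \<le> 128 * (7 * 10 ^ 9 * ((256 * exp \<Lambda>) * (exp \<Lambda> / 2))) * exp (2 * \<Lambda>)"
      by (intro mult_mono) auto
    also have "\<dots> = 128 * 7 * 10 ^ 9 * 128 * exp (4 * \<Lambda>)"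
      by (simp add: exp_add[symmetric])
    also have "\<dots> \<le> 2 ^ 47 * exp (4 * \<Lambda>)" by simp
    also have "\<dots> \<le> exp (real 47 * \<Lambda>) * exp (4 * \<Lambda>)"
      using exp_multiple_ge_power_two[OF \<Lambda>, of 47] by (intro mult_right_mono) auto
    also have "\<dots> = exp (51 * \<Lambda>)" by (simp add: exp_add[symmetric])
    finally show ?thesis .
  qed
  ultimately have 3: "X \<ge> 128 * real n * exp (2 * \<Lambda>)" by linarith
  have "1 / 10 ^ 13 * \<alpha> / \<Lambda> ^ 5 \<le> \<alpha> / (28 * 10 ^ 9 * \<Lambda> ^ 4)"
  proof -
    have "28 * 10 ^ 9 * \<Lambda> ^ 4 * 1 \<le> 28 * 10 ^ 9 * \<Lambda> ^ 4 * (2 * \<Lambda>)"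
      using \<Lambda>2 by (intro mult_left_mono) auto
    also have "\<dots> \<le> 10 ^ 13 * \<Lambda> ^ 5"
      using \<Lambda>2 by (simp add: eval_nat_numeral)
    finally have "28 * 10 ^ 9 * \<Lambda> ^ 4 \<le> 10 ^ 13 * \<Lambda> ^ 5" by simp
    then have "\<alpha> / (10 ^ 13 * \<Lambda> ^ 5) \<le> \<alpha> / (28 * 10 ^ 9 * \<Lambda> ^ 4)"
      using \<alpha> \<Lambda>2 by (intro divide_left_mono) auto
    then show ?thesis by simp
  qed
  then have "1 / 10 ^ 13 * \<alpha> / \<Lambda> ^ 5 \<le> 1 / (4 * real n)" using scale by linarith
  then have 4: "real N powr (1 / 10 ^ 13 * \<alpha> / \<Lambda> ^ 5) \<le> X"
    unfolding X_def using N by (intro powr_mono) auto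
  have "X ^ (4 * n) = X powr real (4 * n)" by (rule powr_realpow[symmetric]) (use N in \<open>simp add: X_def\<close>)
  also have "\<dots> = real N" using n N by (simp add: X_def powr_powr)
  finally show ?thesis using that X_def 3 4 by blast
qed

lemma density_bounds:
  assumes "E \<subseteq> U" "E \<noteq> {}" "finite U"
  shows "0 < real (card E) / real (card U) \<and> real (card E) / real (card U) \<le> 1"
proof -
  have "finite E" using assms finite_subset by blast
  then have "card E \<le> card U" "0 < card E"
    using assms by (auto simp: card_gt_0_iff intro: card_mono)
  then show ?thesis by simp
qed

section \<open>A long progression inside the Bohr set\<close>

context cyclic
begin

lemma long_progression_of_popular_sums:
  fixes \<alpha> \<beta> \<gamma> \<Lambda> :: real
  assumes A: "A \<subseteq> res" "A \<noteq> {}" and B: "B \<subseteq> res" "B \<noteq> {}" and C: "C \<subseteq> res" "C \<noteq> {}"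
    and \<alpha>: "\<alpha> = real (card A) / real N" and \<beta>: "\<beta> = real (card B) / real N" and \<gamma>: "\<gamma> = real (card C) / real N"
    and \<Lambda>: "\<Lambda> = ln (2 / (\<alpha> * \<beta> * \<gamma>))"
    and large: "10 ^ 13 * \<Lambda> ^ 7 \<le> \<alpha> * ln (real N)"
  obtains x :: int and q L :: nat where "real L \<ge> real N powr (1 / 10 ^ 13 * \<alpha> / \<Lambda> ^ 5)"
    "\<And>a. inj_on (\<lambda>i. (a + i * q) mod N) {..<L}"
    "\<And>i. i < L \<Longrightarrow> (\<Sum>c\<in>C. \<Sum>b\<in>B. of_bool ((x + int i * int q - c - b) mod int N \<in> A))
      \<ge> \<alpha> / 2 * real (card B) * real (card C)"
proof -
  have \<alpha>1: "0 < \<alpha>" "\<alpha> \<le> 1" and \<beta>1: "0 < \<beta>" "\<beta> \<le> 1" and \<gamma>1: "0 < \<gamma>" "\<gamma> \<le> 1"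
    using density_bounds[OF A] density_bounds[OF B] density_bounds[OF C] by (simp_all add: \<alpha> \<beta> \<gamma>)
  have e\<Lambda>: "exp \<Lambda> = 2 / (\<alpha> * \<beta> * \<gamma>)" using \<alpha>1 \<beta>1 \<gamma>1 by (simp add: \<Lambda>)
  have inv: "1 / u \<le> exp \<Lambda> / 2" if "\<alpha> * \<beta> * \<gamma> \<le> u" for u
  proof -
    have "0 < \<alpha> * \<beta> * \<gamma>" using \<alpha>1 \<beta>1 \<gamma>1 by simp
    then have "1 / u \<le> 1 / (\<alpha> * \<beta> * \<gamma>)" using that by (intro divide_left_mono) auto
    then show ?thesis by (simp add: e\<Lambda>)
  qed
  define M where "M = 1 / (\<alpha> * \<gamma>)"
  have le: "\<alpha> * \<beta> * \<gamma> \<le> \<alpha>" "\<alpha> * \<beta> * \<gamma> \<le> \<beta>" "\<alpha> * \<beta> * \<gamma> \<le> \<alpha> * \<gamma>" "\<alpha> * \<gamma> \<le> 1" "\<alpha> * \<beta> * \<gamma> \<le> 1"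
    using \<alpha>1 \<beta>1 \<gamma>1 mult_le_one[of \<alpha> \<gamma>] mult_le_one[of \<beta> \<gamma>] mult_le_one[of \<alpha> "\<beta> * \<gamma>"]
      mult_left_mono[of "\<beta> * \<gamma>" 1 \<alpha>] mult_left_mono[of "\<alpha> * \<gamma>" 1 \<beta>] mult_right_mono[of \<beta> 1 "\<alpha> * \<gamma>"]
    by (simp_all add: mult_ac)
  have inv\<alpha>: "1 / \<alpha> \<le> exp \<Lambda> / 2" and inv\<beta>: "1 / \<beta> \<le> exp \<Lambda> / 2" and Mle: "M \<le> exp \<Lambda> / 2"
    using inv le by (auto simp: M_def)
  have M1: "1 \<le> M" using \<alpha>1 \<gamma>1 le by (simp add: M_def)
  have "2 \<le> exp \<Lambda>" using inv[OF le(5)] by simp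
  then have \<Lambda>2: "ln 2 \<le> \<Lambda>" by (metis ln_exp ln_mono zero_less_numeral)
  have \<Lambda>h: "\<Lambda> \<ge> 1 / 2" using \<Lambda>2 ln2_ge_two_thirds by simp
  define W \<eta> where "W = ln (1 + 4 / \<alpha>)" and "\<eta> = exp (- 2 * \<Lambda>) / 8"
  obtain k l :: nat where kl: "l > 0" "2 * (1 / 4) ^ l \<le> \<eta>" "k > 0"
    "256 * real l * W * M * exp (- (real k * \<alpha> / (16 * (128 * real l)\<^sup>2))) \<le> 1"
    "8 * sqrt M * W * \<eta> \<le> 1" "real k + 1 \<le> 4 * 10 ^ 8 * \<Lambda> ^ 3 / \<alpha>"
    using parameter_choice[OF \<alpha>1 inv\<alpha> M1 Mle \<Lambda>2] unfolding W_def \<eta>_def by blast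
  obtain x D where D: "D \<subseteq> res" "real (card D) \<le> 16 * (ln 2 + real k * ln (1 / \<beta>))"
    and pop: "\<And>t. (\<Sum>d\<in>D. norm (ee d t - 1)) \<le> \<eta>
      \<Longrightarrow> (\<Sum>c\<in>C. \<Sum>b\<in>B. of_bool ((x + t - c - b) mod int N \<in> A))
        \<ge> \<alpha> / 2 * real (card B) * real (card C)"
  proof (rule bohr_set_of_popular_sums[OF A B C \<alpha> \<beta> \<gamma> M_def W_def kl(1-5)], goal_cases)
    case 1
    show ?case by (rule 1(1)[OF 1(2-4)])
  qed
  \<comment> \<open>The frequencies in \<open>D\<close> together with 1/N.\<close>
  define n where "n = card D + 1"
  have "real n \<le> 7 * 10 ^ 9 * \<Lambda> ^ 4 / \<alpha>"
  proof -
    have "ln (1 / \<beta>) \<le> \<Lambda>"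
    proof -
      have "ln (1 / \<beta>) \<le> ln (exp \<Lambda>)" using inv\<beta> \<beta>1 exp_gt_zero[of \<Lambda>] by (intro ln_mono) (linarith | simp)+
      then show ?thesis by simp
    qed
    then have "real (card D) \<le> 16 * (\<Lambda> + real k * \<Lambda>)"
      using D(2) \<Lambda>2 by (smt (verit) mult_left_mono of_nat_0_le_iff)
    also have "\<dots> = 16 * \<Lambda> * (real k + 1)" by (simp add: algebra_simps)
    also have "\<dots> \<le> 16 * \<Lambda> * (4 * 10 ^ 8 * \<Lambda> ^ 3 / \<alpha>)" using kl(6) \<Lambda>h by (intro mult_left_mono) auto
    also have "\<dots> = 64 * 10 ^ 8 * (\<Lambda> ^ 4 / \<alpha>)" by (simp add: power4_eq_xxxx power3_eq_cube)
    finally have "real (card D) \<le> 64 * 10 ^ 8 * (\<Lambda> ^ 4 / \<alpha>)" .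
    moreover have "1 \<le> 16 * (\<Lambda> ^ 4 / \<alpha>)"
    proof -
      have "1 \<le> 16 * \<Lambda> ^ 4" using power_mono[OF \<Lambda>h, of 4] by (simp add: power_divide)
      then show ?thesis using \<alpha>1 by (simp add: pos_le_divide_eq)
    qed
    moreover have "7 * 10 ^ 9 * \<Lambda> ^ 4 / \<alpha> = 7 * 10 ^ 9 * (\<Lambda> ^ 4 / \<alpha>)" by simp
    ultimately show ?thesis unfolding n_def by simp
  qed
  then obtain X :: real where X: "X = real N powr (1 / (4 * real n))" "X ^ (4 * n) = real N"
    "X \<ge> 128 * real n * exp (2 * \<Lambda>)" "X \<ge> real N powr (1 / 10 ^ 13 * \<alpha> / \<Lambda> ^ 5)"
    using progression_scale[OF \<alpha>1 inv\<alpha> \<Lambda>2 N_pos _ _ large, of n] by (auto simp: n_def)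
  have "128 * 1 * 1 \<le> 128 * real n * exp (2 * \<Lambda>)"
    using \<Lambda>h by (intro mult_mono) (auto simp: n_def)
  then have X128: "X \<ge> 128" using X(3) by linarith
  have XX: "128 * X \<le> X\<^sup>2" using X128 by (simp add: power2_eq_square)
  \<comment> \<open>With m about X^2, a multiple i q with i at most X has error i/m of order 1/X at
    each frequency in \<open>D\<close>.\<close>
  define m L where "m = nat \<lfloor>X\<^sup>2\<rfloor>" and "L = nat \<lceil>X\<rceil>"
  have m: "real m \<le> X\<^sup>2" "X\<^sup>2 / 2 \<le> real m" and L: "X \<le> real L" "real L < X + 1"
    using XX X128 unfolding m_def L_def by linarith+
  have m0: "m > 0" and Lm: "L \<le> m" using m L X128 XX by linarith+
  have "real (m ^ n) \<le> (X\<^sup>2) ^ n" using m(1) by (simp add: power_mono)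
  also have "\<dots> < (X\<^sup>2) ^ n * (X\<^sup>2) ^ n"
  proof -
    have "1 < X\<^sup>2" using XX X128 by linarith
    then have "1 < (X\<^sup>2) ^ n" by (rule one_less_power) (simp add: n_def)
    then show ?thesis by simp
  qed
  also have "\<dots> = real N" using X(2) by (simp add: power_mult[symmetric] power_add[symmetric])
  finally have mN: "m ^ (card D + 1) < N" by (simp only: of_nat_less_iff n_def)
  obtain q :: nat where q: 
    "\<And>d i. d \<in> D \<Longrightarrow> norm (ee d (int i * int q) - 1) \<le> real i * (2 * pi / real m)"
    "\<And>a. inj_on (\<lambda>i. (a + i * q) mod N) {..<m}"
  proof (rule dirichlet_progression[OF finite_subset[OF D(1) finite_res] m0 mN], goal_cases)
    case 1
    show ?case by (rule 1(1)[OF 1(2,3)])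
  qed
  show ?thesis
  proof (rule that[of L q x])
    show "real L \<ge> real N powr (1 / 10 ^ 13 * \<alpha> / \<Lambda> ^ 5)" using X(4) L(1) by linarith
    show "inj_on (\<lambda>i. (a + i * q) mod N) {..<L}" for a
      by (rule inj_on_subset[OF q(2)]) (use Lm in auto)
    fix i assume "i < L"
    \<comment> \<open>\<open>L\<close> rounds \<open>X\<close> up, but the last index L - 1 is still
      below \<open>X\<close>.\<close>
    then have "real i \<le> real L - 1" by linarith
    then have i: "real i \<le> X" using L(2) by linarith
    have "(\<Sum>d\<in>D. norm (ee d (int i * int q) - 1)) \<le> (\<Sum>d\<in>D. real i * (2 * pi / real m))"
      by (intro sum_mono q(1))
    also have "\<dots> = real (card D) * (real i * (2 * pi / real m))" by simp
    also have "\<dots> \<le> real n * (X * (8 / (X\<^sup>2 / 2)))"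
    proof (intro mult_mono)
      have "2 * pi / real m \<le> 8 / real m" using pi_less_4 by (intro divide_right_mono) auto
      also have "\<dots> \<le> 8 / (X\<^sup>2 / 2)" using m X128 by (intro divide_left_mono) (auto simp: m0)
      finally show "2 * pi / real m \<le> 8 / (X\<^sup>2 / 2)" .
    qed (use i X128 in \<open>auto simp: n_def\<close>)
    also have "\<dots> = 16 * real n / X" using X128 by (simp add: power2_eq_square)
    also have "\<dots> \<le> \<eta>"
    proof -
      \<comment> \<open>The lower bound required of \<open>X\<close> in
        \<open>progression_scale\<close> was chosen for this cancellation.\<close>
      have "16 * real n = \<eta> * (128 * real n * exp (2 * \<Lambda>))"
        by (simp add: \<eta>_def exp_minus field_simps)
      also have "\<dots> \<le> \<eta> * X" using X(3) by (intro mult_left_mono) (auto simp: \<eta>_def)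
      finally show ?thesis using X128 by (simp add: pos_divide_le_eq)
    qed
    finally show "(\<Sum>c\<in>C. \<Sum>b\<in>B. of_bool ((x + int i * int q - c - b) mod int N \<in> A))
        \<ge> \<alpha> / 2 * real (card B) * real (card C)"
      by (rule pop)
  qed
qed

end

section \<open>From popular sums over the integers to representations of residues\<close>

lemma reps3_ge_sum:
  assumes A: "A \<subseteq> {..<N}" and B: "finite B" and C: "finite C" and N: "N > 0"
    and t: "int t mod int N = z mod int N"
  shows "(\<Sum>c\<in>int ` C. \<Sum>b\<in>int ` B. of_bool ((z - c - b) mod int N \<in> int ` A)) \<le> real (reps3 N A B C t)"
proof -
  let ?P = "\<lambda>c b. (z - int c - int b) mod int N \<in> int ` A"
  let ?R = "{(x, y, w). x \<in> A \<and> y \<in> B \<and> w \<in> C \<and> (x + y + w) mod N = t mod N}"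
  let ?g = "\<lambda>(c, b). (nat ((z - int c - int b) mod int N), b, c)"
  have "(\<Sum>c\<in>int ` C. \<Sum>b\<in>int ` B. of_bool ((z - c - b) mod int N \<in> int ` A)) = (\<Sum>c\<in>C. \<Sum>b\<in>B. of_bool (?P c b) :: real)"
    by (simp add: sum.reindex)
  also have "\<dots> = (\<Sum>(c, b)\<in>C \<times> B. of_bool (?P c b))" by (rule sum.cartesian_product)
  also have "\<dots> = real (card {(c, b). (c, b) \<in> C \<times> B \<and> ?P c b})"
  proof -
    have "(\<Sum>(c, b)\<in>C \<times> B. of_bool (?P c b)) = (\<Sum>p\<in>C \<times> B. if ?P (fst p) (snd p) then 1 else 0 :: real)"
      by (intro sum.cong refl) auto
    also have "\<dots> = real (card (C \<times> B \<inter> {p. ?P (fst p) (snd p)}))"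
      using B C by (simp add: sum.If_cases)
    also have "C \<times> B \<inter> {p. ?P (fst p) (snd p)} = {(c, b). (c, b) \<in> C \<times> B \<and> ?P c b}" by auto
    finally show ?thesis .
  qed
  also have "\<dots> \<le> real (card ?R)"
  proof -
    \<comment> \<open>A pair (c, b) determines the remaining summand as the residue of z - c - b, so
      distinct pairs give distinct representations.\<close>
    have "card {(c, b). (c, b) \<in> C \<times> B \<and> ?P c b} \<le> card ?R"
    proof (rule card_inj_on_le[of ?g])
      show "inj_on ?g {(c, b). (c, b) \<in> C \<times> B \<and> ?P c b}" by (auto simp: inj_on_def)
      show "?g ` {(c, b). (c, b) \<in> C \<times> B \<and> ?P c b} \<subseteq> ?R"
      proof clarify
        fix c b a assume cb: "c \<in> C" "b \<in> B" "a \<in> A" "(z - int c - int b) mod int N = int a"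
        have "int ((a + b + c) mod N) = ((z - int c - int b) mod int N + int b + int c) mod int N"
          by (simp add: zmod_int cb(4))
        also have "\<dots> = z mod int N" by (simp add: add.assoc mod_add_left_eq)
        also have "\<dots> = int (t mod N)" using t by (simp add: zmod_int)
        finally show "nat ((z - int c - int b) mod int N) \<in> A \<and> b \<in> B \<and> c \<in> C
            \<and> (nat ((z - int c - int b) mod int N) + b + c) mod N = t mod N"
          using cb by simp
      qed
      have "?R \<subseteq> A \<times> B \<times> C" by auto
      then show "finite ?R" using A B C finite_subset[OF A] by (meson finite_SigmaI finite_lessThan finite_subset)
    qed
    then show ?thesis by simp
  qed
  finally show ?thesis by (simp add: reps3_def)
qed

lemma mem_sumset3_if_reps3_pos:
  assumes "reps3 N A B C t > 0" "t < N"
  shows "t \<in> sumset3 N A B C"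
proof -
  have "{(x, y, z). x \<in> A \<and> y \<in> B \<and> z \<in> C \<and> (x + y + z) mod N = t mod N} \<noteq> {}"
    using assms(1) unfolding reps3_def by (metis card.empty less_irrefl)
  then show ?thesis using assms(2) by (auto simp: sumset3_def)
qed

theorem theorem1p5:
  shows "\<exists>c::real. c > 0 \<and>
    (\<forall>(N::nat) A B C.
       real N \<ge> 1 + exp (exp (exp 1)) \<and>
       A \<subseteq> {..<N} \<and> B \<subseteq> {..<N} \<and> C \<subseteq> {..<N} \<and>
       A \<noteq> {} \<and> B \<noteq> {} \<and> C \<noteq> {} \<and>
       (let \<alpha> = real (card A) / real N; \<beta> = real (card B) / real N;
            \<gamma> = real (card C) / real N; \<Lambda> = ln (2 / (\<alpha> * \<beta> * \<gamma>)) in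
          \<alpha> * \<Lambda> powr (-7) \<ge> inverse (c * ln (real N)))
     \<longrightarrow>
       (let \<alpha> = real (card A) / real N; \<beta> = real (card B) / real N;
            \<gamma> = real (card C) / real N; \<Lambda> = ln (2 / (\<alpha> * \<beta> * \<gamma>)) in
        \<exists>a d L::nat.
          real L \<ge> real N powr (c * \<alpha> / \<Lambda> ^ 5) \<and>
          proper_ap_mod N a d L \<and>
          ap_mod N a d L \<subseteq> sumset3 N A B C \<and>
          (\<forall>t \<in> ap_mod N a d L.
             real (reps3 N A B C t) \<ge> exp (- inverse (c * \<alpha>) * \<Lambda> ^ 7) * real N ^ 2)))"
\<comment> \<open>A smaller constant strengthens the hypothesis and weakens both conclusions; 10^13
  is what \<open>progression_scale\<close> absorbs.\<close>
proof (intro exI[of _ "1 / 10 ^ 13 :: real"] conjI allI impI, goal_cases)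
  case (2 N A B C)
  define \<alpha> \<beta> \<gamma> \<Lambda> where "\<alpha> = real (card A) / real N" and "\<beta> = real (card B) / real N"
    and "\<gamma> = real (card C) / real N" and "\<Lambda> = ln (2 / (\<alpha> * \<beta> * \<gamma>))"
  have "0 < exp (exp (exp 1 :: real))" by simp
  then have N1: "real N > 1" using 2 by linarith
  have sub: "A \<subseteq> {..<N}" "B \<subseteq> {..<N}" "C \<subseteq> {..<N}"
    and ne: "A \<noteq> {}" "B \<noteq> {}" "C \<noteq> {}"
    and hyp: "inverse (1 / 10 ^ 13 * ln (real N)) \<le> \<alpha> * \<Lambda> powr (-7)"
    using 2 unfolding Let_def \<alpha>_def \<beta>_def \<gamma>_def \<Lambda>_def by blast+
  interpret cyclic N by unfold_locales (use N1 in auto)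
  have fin: "finite A" "finite B" "finite C" using sub finite_subset by blast+
  have \<alpha>1: "0 < \<alpha>" "\<alpha> \<le> 1" and \<beta>1: "0 < \<beta>" "\<beta> \<le> 1" and \<gamma>1: "0 < \<gamma>" "\<gamma> \<le> 1"
    using density_bounds[OF sub(1) ne(1)] density_bounds[OF sub(2) ne(2)] density_bounds[OF sub(3) ne(3)]
    by (simp_all add: \<alpha>_def \<beta>_def \<gamma>_def)
  have prod1: "0 < \<alpha> * \<beta> * \<gamma>" "\<alpha> * \<beta> * \<gamma> \<le> 1"
    using \<alpha>1 \<beta>1 \<gamma>1 by (auto intro!: mult_le_one)
  have "ln 2 \<le> \<Lambda>" unfolding \<Lambda>_def using prod1 by (intro ln_mono) (auto simp: pos_le_divide_eq)
  then have \<Lambda>h: "1 / 2 \<le> \<Lambda>" using ln2_ge_two_thirds by simp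
  have lnN: "ln (real N) > 0" using N1 by simp
  have large: "10 ^ 13 * \<Lambda> ^ 7 \<le> \<alpha> * ln (real N)"
  proof -
    have "\<Lambda> powr (-7) = inverse (\<Lambda> ^ 7)"
      using \<Lambda>h powr_realpow[of \<Lambda> 7] by (simp add: powr_minus)
    then have "\<alpha> * \<Lambda> powr (-7) = \<alpha> / \<Lambda> ^ 7" by (simp add: divide_inverse)
    moreover have "inverse (1 / 10 ^ 13 * ln (real N)) = 10 ^ 13 / ln (real N)" by simp
    ultimately have "10 ^ 13 / ln (real N) \<le> \<alpha> / \<Lambda> ^ 7" using hyp by linarith
    then have "10 ^ 13 / ln (real N) * (\<Lambda> ^ 7 * ln (real N)) \<le> \<alpha> / \<Lambda> ^ 7 * (\<Lambda> ^ 7 * ln (real N))"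
      using \<Lambda>h lnN by (intro mult_right_mono) auto
    then show ?thesis using \<Lambda>h lnN by simp
  qed
  let ?i = "(`) int"
  have card_i: "card (?i E) = card E" for E by (simp add: card_image)
  have i: "?i A \<subseteq> res" "?i B \<subseteq> res" "?i C \<subseteq> res" "?i A \<noteq> {}" "?i B \<noteq> {}" "?i C \<noteq> {}"
    using sub ne by (auto simp: res_def)
  have "\<alpha> = real (card (?i A)) / real N" "\<beta> = real (card (?i B)) / real N" "\<gamma> = real (card (?i C)) / real N"
    by (simp_all add: \<alpha>_def \<beta>_def \<gamma>_def card_i)
  note progression = long_progression_of_popular_sums[OF i(1,4,2,5,3,6) this \<Lambda>_def large, unfolded card_i]
  obtain x :: int and q L :: nat where L: "real L \<ge> real N powr (1 / 10 ^ 13 * \<alpha> / \<Lambda> ^ 5)"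
    "\<And>a. inj_on (\<lambda>i. (a + i * q) mod N) {..<L}"
    and pop: "\<And>i. i < L \<Longrightarrow> (\<Sum>c\<in>?i C. \<Sum>b\<in>?i B. of_bool ((x + int i * int q - c - b) mod int N \<in> ?i A))
      \<ge> \<alpha> / 2 * real (card B) * real (card C)"
  proof (rule progression, goal_cases)
    case 1
    show ?case by (rule 1(1)[OF 1(2-4)])
  qed
  define a where "a = nat (x mod int N)"
  \<comment> \<open>By the definition of \<Lambda>, exp(-\<Lambda>) is \<alpha>\<beta>\<gamma>/2, so
    this is the popularity bound \<open>\<alpha> / 2 * card B * card C\<close> rewritten.\<close>
  have reps: "exp (- \<Lambda>) * real N ^ 2 \<le> real (reps3 N A B C t)" if t: "t \<in> ap_mod N a q L" for t
  proof -
    obtain i where i: "i < L" "t = (a + i * q) mod N" using t by (auto simp: ap_mod_def)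
    have "int t mod int N = (x + int i * int q) mod int N"
      using N_pos by (simp add: i(2) a_def zmod_int mod_simps)
    note reps3_ge_sum[OF sub(1) fin(2,3) N_pos this]
    moreover have "exp (- \<Lambda>) * real N ^ 2 = \<alpha> / 2 * real (card B) * real (card C)"
    proof -
      have "exp (- \<Lambda>) = \<alpha> * \<beta> * \<gamma> / 2" using prod1 by (simp add: \<Lambda>_def exp_minus)
      then show ?thesis using N_pos by (simp add: \<beta>_def \<gamma>_def power2_eq_square)
    qed
    ultimately show ?thesis using pop[OF i(1)] by linarith
  qed
  \<comment> \<open>Since \<Lambda> >= 1/2, \<Lambda> is at most 64 \<Lambda>^7, which the constant
    10^13 covers.\<close>
  have weaker: "exp (- inverse (1 / 10 ^ 13 * \<alpha>) * \<Lambda> ^ 7) \<le> exp (- \<Lambda>)"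
  proof -
    have "\<Lambda> = (1 / 2) ^ 6 * \<Lambda> * 64" by (simp add: power_divide)
    also have "\<dots> \<le> \<Lambda> ^ 6 * \<Lambda> * 10 ^ 13" using \<Lambda>h by (intro mult_mono power_mono) auto
    also have "\<dots> = 10 ^ 13 * \<Lambda> ^ 7 * 1" by (simp add: eval_nat_numeral)
    also have "\<dots> \<le> 10 ^ 13 * \<Lambda> ^ 7 * (1 / \<alpha>)" using \<alpha>1 \<Lambda>h by (intro mult_left_mono) auto
    also have "\<dots> = inverse (1 / 10 ^ 13 * \<alpha>) * \<Lambda> ^ 7" by simp
    finally show ?thesis by (simp only: mult_minus_left exp_le_cancel_iff neg_le_iff_le)
  qed
  have "ap_mod N a q L \<subseteq> sumset3 N A B C"
  proof
    fix t assume t: "t \<in> ap_mod N a q L"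
    have "0 < exp (- \<Lambda>) * real N ^ 2" using N_pos by simp
    then have "0 < reps3 N A B C t" using reps[OF t] by linarith
    moreover have "t < N" using t N_pos by (auto simp: ap_mod_def)
    ultimately show "t \<in> sumset3 N A B C" by (rule mem_sumset3_if_reps3_pos)
  qed
  moreover have "exp (- inverse (1 / 10 ^ 13 * \<alpha>) * \<Lambda> ^ 7) * real N ^ 2 \<le> real (reps3 N A B C t)"
    if "t \<in> ap_mod N a q L" for t
    using mult_right_mono[OF weaker, of "real N ^ 2"] reps[OF that] by simp
  moreover have "proper_ap_mod N a q L" unfolding proper_ap_mod_def by (rule L(2))
  ultimately show ?case
    unfolding Let_def \<alpha>_def[symmetric] \<beta>_def[symmetric] \<gamma>_def[symmetric] \<Lambda>_def[symmetric]
    using L(1) by blast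
qed simp

end
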